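(* Let $\alpha=\{\alpha_1,\ldots,\alpha_n\}\subset\mathbb Z[x]^m$, let $A=(a_{ij})_{m\times n}$ be the matrix with $\alpha_i$ as its $i$-th column, and assume that $A$ has rank $m$. For $i=1,\ldots,m$ let $$o_i=\max_{1\le k\le n}\deg(a_{ik},x),\qquad \underline o_i=\min_{1\le k\le n}\underline{\deg}(a_{ik},x),$$ where $\deg(0,x)=-\infty$, $\underline{\deg}(p,x)=\min\{k\in\mathbb N\mid \text{the coefficient of }x^k\text{ in }p\text{ is nonzero}\}$ for $p\ne0$, and $\underline{\deg}(0,x)=0$. Let $X_\alpha$ be the toric $\sigma$-variety over $\mathbb Q$ defined by $\alpha$. Then $$\mathrm{ord}(X_\alpha)\le\sum_{i=1}^m(o_i-\underline o_i).$$
   Context: $\mathbb Q$ is a difference field with $\sigma=\mathrm{id}$; $\mathbb T=(t_1,\ldots,t_m)$, $\mathbb Y=\{y_1,\ldots,y_n\}$ are $\sigma$-indeterminates; for $p=\sum_ic_ix^i\in\mathbb Z[x]$, $a^p=\prod_i\sigma^i(a)^{c_i}$, and $\mathbb T^\beta=\prod_jt_j^{\beta_j}$ for $\beta\in\mathbb Z[x]^m$. The toric $\sigma$-variety $X_\alpha\subset\mathbb A^n$ is the zero set (over all $\sigma$-field extensions of $\mathbb Q$) of the reflexive prime $\sigma$-ideal $\mathcal I_\alpha=\{f\in\mathbb Q\{\mathbb Y\}\mid f(\mathbb T^{\alpha_1},\ldots,\mathbb T^{\alpha_n})=0\}$, which has generic point $\eta=(\mathbb T^{\alpha_1},\ldots,\mathbb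 T^{\alpha_n})$. For an irreducible $\sigma$-variety $X$ with generic point $\eta=(\eta_1,\ldots,\eta_n)$ and dimension $d$ (the $\sigma$-transcendence degree of $\mathbb Q\langle\eta\rangle$ over $\mathbb Q$), the order $\mathrm{ord}(X)$ is the integer $h$ such that for all sufficiently large $t$ the transcendence degree over $\mathbb Q$ of $\mathbb Q(\sigma^j(\eta_i)\mid 1\le i\le n,\ 0\le j\le t)$ equals $d(t+1)+h$. *)

theory Defs
  imports
    "HOL-Analysis.Analysis"
    "HOL-Library.Poly_Mapping"
    "HOL-Computational_Algebra.Fraction_Field"
    "HOL-Computational_Algebra.Polynomial_Factorial"
begin

section \<open>Polynomials over the rationals, algebraic independence\<close>

text \<open>
  A polynomial over the rationals in variables of type 'v is an element of
  (('v =>0 nat) =>0 rat), i.e. a finitely supported map from monomials to coefficients.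
  The parameter c of mpoly_eval is the embedding of the rationals in the target ring.
\<close>

type_synonym 'v ratpoly = "('v \<Rightarrow>\<^sub>0 nat) \<Rightarrow>\<^sub>0 rat"

definition monom_eval :: "('v \<Rightarrow> 'a::comm_ring_1) \<Rightarrow> ('v \<Rightarrow>\<^sub>0 nat) \<Rightarrow> 'a" where
  "monom_eval x m = (\<Prod>v\<in>Poly_Mapping.keys m. x v ^ Poly_Mapping.lookup m v)"

definition mpoly_eval :: "(rat \<Rightarrow> 'a::comm_ring_1) \<Rightarrow> ('v \<Rightarrow> 'a) \<Rightarrow> 'v ratpoly \<Rightarrow> 'a" where
  "mpoly_eval c x p = (\<Sum>m\<in>Poly_Mapping.keys p. c (Poly_Mapping.lookup p m) * monom_eval x m)"

definition mpoly_vars :: "'v ratpoly \<Rightarrow> 'v set" where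
  "mpoly_vars p = (\<Union>m\<in>Poly_Mapping.keys p. Poly_Mapping.keys m)"

text \<open>Independence over the rationals of a family indexed by I (not just of the set of its values).\<close>

definition alg_independent :: "('v \<Rightarrow> 'k::field_char_0) \<Rightarrow> 'v set \<Rightarrow> bool" where
  "alg_independent x I \<longleftrightarrow>
     (\<forall>p. mpoly_vars p \<subseteq> I \<and> mpoly_eval of_rat x p = 0 \<longrightarrow> p = 0)"

definition is_subfield :: "'k::field set \<Rightarrow> bool" where
  "is_subfield F \<longleftrightarrow> 0 \<in> F \<and> 1 \<in> F \<and>
     (\<forall>a\<in>F. \<forall>b\<in>F. a + b \<in> F \<and> a * b \<in> F) \<and> (\<forall>a\<in>F. - a \<in> F \<and> inverse a \<in> F)"

text \<open>
  In a field of characteristic zero every subfield contains the rationals, so the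
  subfield hull of S is the field generated by S over the rationals.
\<close>

abbreviation rat_adjoin :: "'k::field_char_0 set \<Rightarrow> 'k set" where
  "rat_adjoin S \<equiv> is_subfield hull S"

definition trdeg :: "'k::field_char_0 set \<Rightarrow> enat" where
  "trdeg F = (SUP B \<in> {B. B \<subseteq> F \<and> finite B \<and> alg_independent (\<lambda>b. b) B}. enat (card B))"


section \<open>Difference fields\<close>

text \<open>
  Here \<open>\<sigma>\<close> is automatically injective and the identity on the rationals,
  so these are exactly the difference field extensions of the rationals with
  the identity as transforming operator.
\<close>

definition difference_field :: "('k::field_char_0 \<Rightarrow> 'k) \<Rightarrow> bool" where
  "difference_field \<sigma> \<longleftrightarrow> \<sigma> 1 = 1 \<and>
     (\<forall>a b. \<sigma> (a + b) = \<sigma> a + \<sigma> b) \<and> (\<forall>a b. \<sigma> (a * b) = \<sigma> a * \<sigma> b)"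

definition sigma_trdeg :: "('k::field_char_0 \<Rightarrow> 'k) \<Rightarrow> 'k set \<Rightarrow> enat" where
  "sigma_trdeg \<sigma> F =
     (SUP B \<in> {B. B \<subseteq> F \<and> finite B \<and>
                  alg_independent (\<lambda>(b, j). (\<sigma> ^^ j) b) (B \<times> (UNIV :: nat set))}. enat (card B))"

text \<open>\<open>Dvar i j\<close> stands for the j-th transform of the i-th difference indeterminate.\<close>

datatype 'i dvar = Dvar (dvar_index: 'i) (dvar_order: nat)

type_synonym 'i diffpoly = "'i dvar ratpoly"

definition sigma_eval :: "('k::field_char_0 \<Rightarrow> 'k) \<Rightarrow> 'k^'n \<Rightarrow> 'n diffpoly \<Rightarrow> 'k" where
  "sigma_eval \<sigma> \<eta> f = mpoly_eval of_rat (\<lambda>v. (\<sigma> ^^ dvar_order v) (\<eta> $ dvar_index v)) f"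

definition sigma_power :: "('k::field_char_0 \<Rightarrow> 'k) \<Rightarrow> 'k \<Rightarrow> int poly \<Rightarrow> 'k" where
  "sigma_power \<sigma> a p = (\<Prod>i\<le>degree p. (\<sigma> ^^ i) a powi coeff p i)"


section \<open>Difference varieties and their order\<close>

text \<open>
  The points, with coordinates in a given difference field extension, of the difference
  variety defined by a set of difference polynomials.
\<close>

definition sigma_zeros :: "('k::field_char_0 \<Rightarrow> 'k) \<Rightarrow> 'n diffpoly set \<Rightarrow> ('k^'n) set" where
  "sigma_zeros \<sigma> I = {\<eta>. \<forall>f\<in>I. sigma_eval \<sigma> \<eta> f = 0}"

text \<open>
  A variety consists of points over all difference field extensions, which no single type
  can hold.  Its points over one extension determine it as soon as that extension contains
  a generic zero of the (prime, reflexive) vanishing ideal \<open>I\<close>.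
\<close>

definition generic_zero :: "('k::field_char_0 \<Rightarrow> 'k) \<Rightarrow> 'n diffpoly set \<Rightarrow> 'k^'n \<Rightarrow> bool" where
  "generic_zero \<sigma> I \<eta> \<longleftrightarrow> {f. sigma_eval \<sigma> \<eta> f = 0} = I"

definition generic_point :: "('k::field_char_0 \<Rightarrow> 'k) \<Rightarrow> ('k^'n) set \<Rightarrow> 'k^'n \<Rightarrow> bool" where
  "generic_point \<sigma> X \<eta> \<longleftrightarrow> \<eta> \<in> X \<and>
     (\<forall>f. sigma_eval \<sigma> \<eta> f = 0 \<longrightarrow> (\<forall>p\<in>X. sigma_eval \<sigma> p f = 0))"

definition point_dim :: "('k::field_char_0 \<Rightarrow> 'k) \<Rightarrow> 'k^'n::finite \<Rightarrow> enat" where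
  "point_dim \<sigma> \<eta> = sigma_trdeg \<sigma> (rat_adjoin {(\<sigma> ^^ j) (\<eta> $ i) | i j. True})"

definition has_order :: "('k::field_char_0 \<Rightarrow> 'k) \<Rightarrow> 'k^'n::finite \<Rightarrow> int \<Rightarrow> bool" where
  "has_order \<sigma> \<eta> h \<longleftrightarrow>
     (\<forall>\<^sub>F t in sequentially.
        ereal_of_enat (trdeg (rat_adjoin {(\<sigma> ^^ j) (\<eta> $ i) | i j. j \<le> t}))
          = ereal_of_enat (point_dim \<sigma> \<eta>) * ereal (real (t + 1)) + ereal (real_of_int h))"

text \<open>
  The order of the irreducible difference variety with set of points X over a difference
  field that is large enough to contain a generic point of it.
\<close>

definition variety_order :: "('k::field_char_0 \<Rightarrow> 'k) \<Rightarrow> ('k^'n::finite) set \<Rightarrow> int" where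
  "variety_order \<sigma> X = (THE h. \<exists>\<eta>. generic_point \<sigma> X \<eta> \<and> has_order \<sigma> \<eta> h)"


section \<open>The field of difference rational functions in the indeterminates T\<close>

text \<open>
  The library proves that polynomials form an integral domain only for linearly ordered
  variables; that is the only reason for the order on the index type.
\<close>

instantiation dvar :: (linorder) linorder
begin

definition less_eq_dvar :: "'a dvar \<Rightarrow> 'a dvar \<Rightarrow> bool" where
  "less_eq_dvar u v \<longleftrightarrow> dvar_index u < dvar_index v \<or>
     dvar_index u = dvar_index v \<and> dvar_order u \<le> dvar_order v"

definition less_dvar :: "'a dvar \<Rightarrow> 'a dvar \<Rightarrow> bool" where
  "less_dvar u v \<longleftrightarrow> u \<le> v \<and> \<not> v \<le> (u :: 'a dvar)"

instance
  by standard (auto simp: less_eq_dvar_def less_dvar_def dvar.expand)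

end

lemma of_nat_fract: "(of_nat n :: 'a::idom fract) = Fract (of_nat n) 1"
  by (induction n) (simp_all add: Zero_fract_def One_fract_def add.commute)

instance fract :: ("{idom, ring_char_0}") field_char_0
proof
  show "inj (of_nat :: nat \<Rightarrow> 'a fract)"
    by (rule injI) (simp add: of_nat_fract eq_fract)
qed

abbreviation (input) mvar :: "'v \<Rightarrow> 'v ratpoly" where
  "mvar v \<equiv> Poly_Mapping.single (Poly_Mapping.single v 1) 1"

fun dvar_shift :: "'i dvar \<Rightarrow> 'i dvar" where
  "dvar_shift (Dvar i j) = Dvar i (Suc j)"

definition diffpoly_shift :: "'i diffpoly \<Rightarrow> 'i diffpoly" where
  "diffpoly_shift = mpoly_eval (Poly_Mapping.single 0) (\<lambda>v. mvar (dvar_shift v))"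

lemma monom_eval_superset:
  assumes "finite V" "Poly_Mapping.keys m \<subseteq> V"
  shows "monom_eval x m = (\<Prod>v\<in>V. x v ^ Poly_Mapping.lookup m v)"
  unfolding monom_eval_def
  by (rule prod.mono_neutral_left) (use assms in \<open>auto simp: in_keys_iff\<close>)

lemma monom_eval_0 [simp]: "monom_eval x 0 = 1"
  by (simp add: monom_eval_def)

lemma monom_eval_add: "monom_eval x (m + m') = monom_eval x m * monom_eval x m'"
proof -
  let ?V = "Poly_Mapping.keys m \<union> Poly_Mapping.keys m'"
  have "monom_eval x (m + m') = (\<Prod>v\<in>?V. x v ^ Poly_Mapping.lookup (m + m') v)"
    by (rule monom_eval_superset) (use Poly_Mapping.keys_add[of m m'] in auto)
  also have "\<dots> = (\<Prod>v\<in>?V. x v ^ Poly_Mapping.lookup m v) * (\<Prod>v\<in>?V. x v ^ Poly_Mapping.lookup m' v)"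
    by (simp add: lookup_add power_add prod.distrib)
  also have "\<dots> = monom_eval x m * monom_eval x m'"
    by (simp add: monom_eval_superset[of ?V])
  finally show ?thesis .
qed

lemma mpoly_eval_superset:
  assumes "c 0 = 0" "finite V" "Poly_Mapping.keys p \<subseteq> V"
  shows "mpoly_eval c x p = (\<Sum>m\<in>V. c (Poly_Mapping.lookup p m) * monom_eval x m)"
  unfolding mpoly_eval_def
  by (rule sum.mono_neutral_left) (use assms in \<open>auto simp: in_keys_iff\<close>)

lemma mpoly_eval_add:
  assumes "c 0 = 0" "\<And>a b. c (a + b) = c a + c b"
  shows "mpoly_eval c x (p + q) = mpoly_eval c x p + mpoly_eval c x q"
proof -
  let ?V = "Poly_Mapping.keys p \<union> Poly_Mapping.keys q"
  have "mpoly_eval c x (p + q) = (\<Sum>m\<in>?V. c (Poly_Mapping.lookup (p + q) m) * monom_eval x m)"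
    by (rule mpoly_eval_superset) (use assms Poly_Mapping.keys_add[of p q] in auto)
  also have "\<dots> = (\<Sum>m\<in>?V. c (Poly_Mapping.lookup p m) * monom_eval x m)
                   + (\<Sum>m\<in>?V. c (Poly_Mapping.lookup q m) * monom_eval x m)"
    by (simp add: lookup_add assms ring_distribs sum.distrib)
  also have "\<dots> = mpoly_eval c x p + mpoly_eval c x q"
    by (simp add: mpoly_eval_superset[of c ?V] assms)
  finally show ?thesis .
qed

lemma mpoly_eval_0 [simp]: "mpoly_eval c x 0 = 0"
  by (simp add: mpoly_eval_def)

lemma mpoly_eval_single:
  assumes "c 0 = 0"
  shows "mpoly_eval c x (Poly_Mapping.single m a) = c a * monom_eval x m"
  by (subst mpoly_eval_superset[of c "{m}"]) (use assms in auto)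

lemma ratpoly_induct [case_names zero add]:
  fixes p :: "'v ratpoly"
  assumes "P 0" "\<And>m a p. P p \<Longrightarrow> P (Poly_Mapping.single m a + p)"
  shows "P p"
proof (induction p rule: update_induct)
  case const
  have "(0 :: 'v ratpoly) = Poly_Mapping.Abs_poly_mapping (\<lambda>_. 0)" by simp
  then show ?case using assms(1) by simp
next
  case (update f m a)
  have "Poly_Mapping.update m a f = Poly_Mapping.single m a + f"
    by (rule poly_mapping_eqI)
       (use update in \<open>auto simp: lookup_update lookup_add lookup_single in_keys_iff when_def\<close>)
  then show ?case using assms(2) update by simp
qed

lemma mpoly_eval_mult:
  assumes c: "c 0 = 0" "\<And>a b. c (a + b) = c a + c b" "\<And>a b. c (a * b) = c a * c b"
  shows "mpoly_eval c x (p * q) = mpoly_eval c x p * mpoly_eval c x q"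
proof (induction p rule: ratpoly_induct)
  case zero
  then show ?case by simp
next
  case (add m a p)
  have *: "mpoly_eval c x (Poly_Mapping.single m a * q)
             = c a * monom_eval x m * mpoly_eval c x q" for q
    by (induction q rule: ratpoly_induct)
       (simp_all add: distrib_left mult_single mpoly_eval_add mpoly_eval_single
          monom_eval_add c mult_ac)
  show ?case
    by (simp add: distrib_right mpoly_eval_add mpoly_eval_single c * add)
qed

lemma diffpoly_shift_0 [simp]: "diffpoly_shift 0 = 0"
  by (simp add: diffpoly_shift_def)

lemma diffpoly_shift_1 [simp]: "diffpoly_shift 1 = 1"
  unfolding diffpoly_shift_def single_one[symmetric]
  by (subst mpoly_eval_single) auto

lemma diffpoly_shift_add: "diffpoly_shift (p + q) = diffpoly_shift p + diffpoly_shift q"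
  unfolding diffpoly_shift_def by (rule mpoly_eval_add) (auto simp: single_add)

lemma diffpoly_shift_mult: "diffpoly_shift (p * q) = diffpoly_shift p * diffpoly_shift q"
  unfolding diffpoly_shift_def by (rule mpoly_eval_mult) (auto simp: single_add mult_single)

lemma dvar_shift_inj: "dvar_shift u = dvar_shift v \<longleftrightarrow> u = v"
  by (cases u; cases v) auto

lemma diffpoly_shift_eq_0_iff [simp]: "diffpoly_shift p = 0 \<longleftrightarrow> p = 0"
proof
  assume p: "diffpoly_shift p = 0"
  define sm :: "('a dvar \<Rightarrow>\<^sub>0 nat) \<Rightarrow> ('a dvar \<Rightarrow>\<^sub>0 nat)"
    where "sm m = (\<Sum>v\<in>Poly_Mapping.keys m.
       Poly_Mapping.single (dvar_shift v) (Poly_Mapping.lookup m v))" for m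
  have pw: "mvar v ^ n = Poly_Mapping.single (Poly_Mapping.single v n) 1" for v :: "'a dvar" and n
    by (induction n) (simp_all add: mult_single single_add[symmetric])
  have pr: "(\<Prod>v\<in>V. Poly_Mapping.single (g v) (1::rat)) = Poly_Mapping.single (\<Sum>v\<in>V. g v) 1"
    if "finite V" for V :: "'a dvar set" and g :: "'a dvar \<Rightarrow> ('a dvar \<Rightarrow>\<^sub>0 nat)"
    using that by (induction V) (simp_all add: mult_single)
  have mon: "monom_eval (\<lambda>v. mvar (dvar_shift v)) m = Poly_Mapping.single (sm m) 1"
    for m :: "'a dvar \<Rightarrow>\<^sub>0 nat"
    unfolding monom_eval_def sm_def pw by (rule pr) simp
  have lsm: "Poly_Mapping.lookup (sm m) (dvar_shift v) = Poly_Mapping.lookup m v" for m v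
    by (simp add: sm_def lookup_sum lookup_single dvar_shift_inj when_def
        in_keys_iff sum.delta' if_distrib)
  have sm_inj: "sm m = sm m' \<longleftrightarrow> m = m'" for m m'
    by (metis lsm poly_mapping_eqI)
  have sh: "diffpoly_shift p
              = (\<Sum>m\<in>Poly_Mapping.keys p. Poly_Mapping.single (sm m) (Poly_Mapping.lookup p m))"
    unfolding diffpoly_shift_def mpoly_eval_def mon by (simp add: mult_single)
  show "p = 0"
  proof (rule poly_mapping_eqI)
    fix m
    have "Poly_Mapping.lookup (diffpoly_shift p) (sm m) = Poly_Mapping.lookup p m"
      by (simp add: sh lookup_sum lookup_single sm_inj when_def in_keys_iff)
    then show "Poly_Mapping.lookup p m = Poly_Mapping.lookup 0 m"
      by (simp add: p)
  qed
qed simp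

definition T_shift :: "'m::linorder diffpoly fract \<Rightarrow> 'm diffpoly fract" where
  "T_shift q = (THE r. \<exists>a b. b \<noteq> 0 \<and> q = Fract a b \<and>
     r = Fract (diffpoly_shift a) (diffpoly_shift b))"

definition T_var :: "'m::linorder \<Rightarrow> 'm diffpoly fract" where
  "T_var j = to_fract (mvar (Dvar j 0))"

lemma T_shift_Fract:
  assumes "b \<noteq> 0"
  shows "T_shift (Fract a b) = Fract (diffpoly_shift a) (diffpoly_shift b)"
  unfolding T_shift_def
proof (rule the_equality)
  show "\<exists>a' b'. b' \<noteq> 0 \<and> Fract a b = Fract a' b' \<and>
      Fract (diffpoly_shift a) (diffpoly_shift b) = Fract (diffpoly_shift a') (diffpoly_shift b')"
    using assms by blast
next
  fix r
  assume "\<exists>a' b'. b' \<noteq> 0 \<and> Fract a b = Fract a' b' \<and>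
      r = Fract (diffpoly_shift a') (diffpoly_shift b')"
  then obtain a' b' where *: "b' \<noteq> 0" "Fract a b = Fract a' b'"
      "r = Fract (diffpoly_shift a') (diffpoly_shift b')"
    by blast
  then have "a * b' = a' * b"
    using assms by (simp add: eq_fract)
  then have "diffpoly_shift a * diffpoly_shift b' = diffpoly_shift a' * diffpoly_shift b"
    by (metis diffpoly_shift_mult)
  then show "r = Fract (diffpoly_shift a) (diffpoly_shift b)"
    using * assms by (simp add: eq_fract)
qed

lemma difference_field_T_shift: "difference_field T_shift"
  unfolding difference_field_def
proof (intro conjI allI)
  show "T_shift 1 = (1 :: 'a diffpoly fract)"
    by (simp add: One_fract_def T_shift_Fract)
next
  fix a b :: "'a diffpoly fract"
  show "T_shift (a + b) = T_shift a + T_shift b"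
    by (cases a; cases b)
       (simp add: T_shift_Fract diffpoly_shift_add diffpoly_shift_mult)
  show "T_shift (a * b) = T_shift a * T_shift b"
    by (cases a; cases b) (simp add: T_shift_Fract diffpoly_shift_mult)
qed


section \<open>Toric difference varieties\<close>

definition T_monomial :: "int poly ^ 'm::{finite,linorder} \<Rightarrow> 'm diffpoly fract" where
  "T_monomial \<beta> = (\<Prod>j\<in>UNIV. sigma_power T_shift (T_var j) (\<beta> $ j))"

definition toric_point :: "int poly ^ 'n ^ 'm::{finite,linorder} \<Rightarrow> ('m diffpoly fract) ^ 'n" where
  "toric_point A = (\<chi> k. T_monomial (column k A))"

definition toric_ideal :: "int poly ^ 'n ^ 'm::{finite,linorder} \<Rightarrow> 'n diffpoly set" where
  "toric_ideal A = {f. sigma_eval T_shift (toric_point A) f = 0}"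

definition toric_variety ::
  "int poly ^ 'n ^ 'm::{finite,linorder} \<Rightarrow> ('k::field_char_0 \<Rightarrow> 'k) \<Rightarrow> ('k^'n) set" where
  "toric_variety A \<sigma> = sigma_zeros \<sigma> (toric_ideal A)"

text \<open>
  Every toric variety has a generic zero in the field of difference rational functions, so
  the latter is always a large enough extension; over any large enough extension, the
  generic points of the variety are the generic zeros of its ideal.
\<close>

lemma generic_zero_toric_point: "generic_zero T_shift (toric_ideal A) (toric_point A)"
  by (simp add: generic_zero_def toric_ideal_def)

lemma generic_point_toric_variety_iff:
  assumes "generic_zero \<sigma> (toric_ideal A) \<eta>"
  shows "generic_point \<sigma> (toric_variety A \<sigma>) \<xi> \<longleftrightarrow> generic_zero \<sigma> (toric_ideal A) \<xi>"
  using assms unfolding generic_point_def generic_zero_def toric_variety_def sigma_zeros_def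
  by blast

text \<open>The rank of a matrix over the integral domain of integer polynomials is its rank
  over the fraction field.\<close>

definition poly_matrix_rank :: "int poly ^ 'n ^ 'm \<Rightarrow> nat" where
  "poly_matrix_rank A = rank (\<chi> i k. to_fract (A $ i $ k))"

definition poly_deg :: "int poly \<Rightarrow> ereal" where
  "poly_deg p = (if p = 0 then - \<infinity> else ereal (real (degree p)))"

definition poly_lower_deg :: "int poly \<Rightarrow> nat" where
  "poly_lower_deg p = (if p = 0 then 0 else (LEAST k. coeff p k \<noteq> 0))"

definition row_deg :: "int poly ^ 'n ^ 'm \<Rightarrow> 'm \<Rightarrow> ereal" where
  "row_deg A i = (MAX k. poly_deg (A $ i $ k))"

definition row_lower_deg :: "int poly ^ 'n ^ 'm \<Rightarrow> 'm \<Rightarrow> nat" where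
  "row_lower_deg A i = (MIN k. poly_lower_deg (A $ i $ k))"

end

theory Submission
  imports Defs
begin

text \<open>
  The transforms of order at most \<open>t\<close> of a generic zero satisfy the same relations as the Laurent
  monomials with exponent vectors \<open>x\<^sup>j \<alpha>\<^sub>k\<close>, \<open>j \<le> t\<close>.  Distinct Laurent monomials are linearly
  independent, so algebraic dependence among these elements is linear dependence over the
  rationals among their exponents: the transcendence degree of the field they generate is the
  dimension \<open>r(t)\<close> of the rational span of the vectors \<open>x\<^sup>j \<alpha>\<^sub>k\<close> (\<open>generic_zero_trdeg\<close>).  Everything
  else is linear algebra.  The i-th coordinate of such a vector only involves powers of \<open>x\<close> between
  the lower degree of row i and its degree plus \<open>t\<close>; counting these powers gives
  \<open>r(t) \<le> m (t + 1) + H\<close>, where \<open>H\<close> is the bound on the order that is to be proved.  As the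
  matrix has rank \<open>m\<close>, some \<open>m\<close> of its columns are independent over the rational functions in \<open>x\<close>,
  and their multiples by powers of \<open>x\<close> give \<open>m (t + 1) \<le> r(t)\<close>.

  The order is defined as the constant term of a function that is eventually affine in \<open>t\<close>, so
  it also has to be shown that \<open>r\<close> is eventually affine with slope \<open>m\<close>, and that \<open>m\<close> is the
  dimension of the variety.  Multiplication by \<open>x\<close> maps the span at stage \<open>t + 1\<close> modulo the one at
  stage \<open>t\<close> onto the next such quotient, so the increments of \<open>r\<close> do not increase
  (\<open>exponent_dim_concave\<close>).  Hence \<open>r(t) - m (t + 1)\<close> is concave, lies between \<open>0\<close> and \<open>H\<close>, and is
  therefore eventually constant.  For the dimension, \<open>b\<close> difference-independent elements that lie
  in the field generated by the transforms of order at most \<open>s\<close> satisfy \<open>b (t + 1) \<le> r(s + t)\<close> for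
  all \<open>t\<close>, so \<open>b \<le> m\<close>, while the coordinates at \<open>m\<close> independent columns are difference-independent
  (\<open>generic_zero_point_dim\<close>).

  The upper bound on transcendence degrees comes from a count of monomials.  If a finite family
  generates the field and the values of its monomials are determined by \<open>r\<close> integer weights, then
  its polynomials of degree at most \<open>N\<close> take values in a rational vector space of dimension
  \<open>O(N\<^sup>r)\<close>; after multiplication by a power of a common denominator this space contains the
  \<open>(d + 1)\<^sup>b\<close> independent monomials with exponents at most \<open>d\<close> in \<open>b\<close> independent elements of the
  field, where \<open>N\<close> is linear in \<open>d\<close> (\<open>alg_independent_card_le_weights\<close>).
\<close>

section \<open>Integer sequences\<close>

text \<open>
  By concavity a negative increment persists and drives the sequence below zero.  So all
  increments are nonnegative, and a bounded increasing integer sequence stabilizes.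
\<close>

lemma concave_bounded_eventually_const:
  fixes s :: "nat \<Rightarrow> int"
  assumes concave: "\<And>t. s (t + 2) - s (t + 1) \<le> s (t + 1) - s t"
    and lower: "\<And>t. 0 \<le> s t" and upper: "\<And>t. s t \<le> H"
  shows "\<exists>h\<le>H. \<forall>\<^sub>F t in sequentially. s t = h"
proof -
  have step: "s t \<le> s (Suc t)" for t
  proof (rule ccontr)
    assume neg: "\<not> s t \<le> s (Suc t)"
    have dec: "s (Suc (t + n)) - s (t + n) \<le> - 1" for n
    proof (induction n)
      case (Suc n)
      then show ?case using concave[of "t + n"] by simp
    qed (use neg in simp)
    have "s (t + n) \<le> s t - int n" for n
    proof (induction n)
      case (Suc n)
      then show ?case using dec[of n] by simp
    qed simp
    from this[of "nat (s t + 1)"] lower[of t] lower[of "t + nat (s t + 1)"] show False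
      by simp
  qed
  have mono: "s a \<le> s b" if "a \<le> b" for a b
    using lift_Suc_mono_le[of s, OF step that] .
  have "range s \<subseteq> {0..H}" using lower upper by auto
  then have "finite (range s)" using finite_subset by blast
  then have "Max (range s) \<in> range s" by (intro Max_in) auto
  then obtain a where a: "s a = Max (range s)" by auto
  have "s t = s a" if "a \<le> t" for t
    using mono[OF that] Max_ge[OF \<open>finite (range s)\<close> rangeI, of t] unfolding a by simp
  then show ?thesis
    using upper[of a] unfolding eventually_sequentially by blast
qed

text \<open>
  Powers of \<open>d + 1\<close> with a larger exponent outgrow any constant multiple; \<open>d = C\<^sup>r\<close> is already
  large enough for a contradiction.
\<close>

lemma exponent_le_if_power_growth_le:
  assumes "\<And>d::nat. (d + 1) ^ b \<le> (C * (d + 1)) ^ r"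
  shows "b \<le> r"
proof (rule ccontr)
  assume "\<not> b \<le> r"
  define d where "d = C ^ r"
  have "(d + 1) ^ (r + 1) \<le> (d + 1) ^ b"
    using \<open>\<not> b \<le> r\<close> by (intro power_increasing) auto
  also have "\<dots> \<le> (C * (d + 1)) ^ r" by (rule assms)
  also have "\<dots> = d * (d + 1) ^ r" unfolding d_def by (rule power_mult_distrib)
  finally have "(d + 1) * (d + 1) ^ r \<le> d * (d + 1) ^ r" by simp
  then show False by simp
qed

section \<open>Rational vector spaces\<close>

text \<open>
  Independence is required of the family and not only of its set of values; it forces \<open>f\<close> to be
  injective, so that the exchange bound on independent subsets of a span applies to the image.
\<close>

lemma (in vector_space) independent_family_card_le:
  assumes "finite M" "finite T" "f ` M \<subseteq> span T"
    and indep: "\<And>c. (\<Sum>m\<in>M. scale (c m) (f m)) = 0 \<Longrightarrow> \<forall>m\<in>M. c m = 0"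
  shows "card M \<le> card T"
proof -
  have inj: "inj_on f M"
  proof (rule inj_onI, rule ccontr)
    fix m m' assume *: "m \<in> M" "m' \<in> M" "f m = f m'" "m \<noteq> m'"
    define c where "c = (\<lambda>k. if k = m then 1 else if k = m' then - 1 else 0 :: 'a)"
    have "(\<Sum>k\<in>M. scale (c k) (f k)) = (\<Sum>k\<in>{m, m'}. scale (c k) (f k))"
      by (rule sum.mono_neutral_right) (use * assms(1) in \<open>auto simp: c_def\<close>)
    also have "\<dots> = 0" using * by (simp add: c_def)
    finally show False using indep[of c] * by (auto simp: c_def)
  qed
  have "independent (f ` M)"
  proof
    assume "dependent (f ` M)"
    then obtain u where u: "\<exists>v\<in>f ` M. u v \<noteq> 0" "(\<Sum>v\<in>f ` M. scale (u v) v) = 0"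
      using dependent_finite[of "f ` M"] assms(1) by auto
    have "(\<Sum>m\<in>M. scale (u (f m)) (f m)) = 0"
      using u(2) by (simp add: sum.reindex[OF inj])
    with indep[of "\<lambda>m. u (f m)"] u(1) show False by auto
  qed
  with independent_span_bound[OF assms(2) this assms(3)] card_image[OF inj] show ?thesis
    by simp
qed

definition rat_scale :: "rat \<Rightarrow> 'k::field_char_0 \<Rightarrow> 'k" where
  "rat_scale q a = of_rat q * a"

interpretation rat_space: vector_space "rat_scale :: rat \<Rightarrow> 'k::field_char_0 \<Rightarrow> 'k"
  by standard (simp_all add: rat_scale_def algebra_simps of_rat_add of_rat_mult)

lemma finite_rats_common_denominator:
  fixes S :: "rat set"
  assumes "finite S"
  shows "\<exists>q::int. q \<noteq> 0 \<and> (\<forall>r\<in>S. of_int q * r \<in> \<int>)"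
  using assms
proof (induction S rule: finite_induct)
  case empty
  show ?case by (rule exI[of _ 1]) simp
next
  case (insert r S)
  then obtain q where q: "q \<noteq> 0" "\<And>r. r \<in> S \<Longrightarrow> of_int q * r \<in> \<int>" by blast
  obtain a b where r: "r = of_int a / of_int b" "b > 0"
    by (metis quotient_of_div quotient_of_denom_pos surj_pair)
  have "of_int (b * q) * s \<in> \<int>" if "s \<in> insert r S" for s
  proof (cases "s \<in> S")
    case True
    have "of_int (b * q) * s = of_int b * (of_int q * s)" by simp
    then show ?thesis using q(2)[OF True] by (simp only: Ints_mult Ints_of_int)
  next
    case False
    then have "of_int (b * q) * s = of_int (q * a)" using that r by (simp add: field_simps)
    then show ?thesis by (simp only: Ints_of_int)
  qed
  then show ?case using q(1) r(2) by (intro exI[of _ "b * q"]) simp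
qed

section \<open>Algebraic independence\<close>

text \<open>
  These monomials correspond to the functions from \<open>J\<close> to \<open>{..d}\<close>.
\<close>

lemma card_monomials_bounded_exponents:
  assumes "finite J"
  shows "card {m :: 'v \<Rightarrow>\<^sub>0 nat. Poly_Mapping.keys m \<subseteq> J \<and> (\<forall>v. Poly_Mapping.lookup m v \<le> d)}
           = (d + 1) ^ card J"
    and "finite {m :: 'v \<Rightarrow>\<^sub>0 nat. Poly_Mapping.keys m \<subseteq> J \<and> (\<forall>v. Poly_Mapping.lookup m v \<le> d)}"
proof -
  let ?M = "{m :: 'v \<Rightarrow>\<^sub>0 nat. Poly_Mapping.keys m \<subseteq> J \<and> (\<forall>v. Poly_Mapping.lookup m v \<le> d)}"
  let ?E = "J \<rightarrow>\<^sub>E {..d}"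
  define g where "g e = Poly_Mapping.Abs_poly_mapping (\<lambda>v. if v \<in> J then e v else 0)" for e :: "'v \<Rightarrow> nat"
  have lg: "Poly_Mapping.lookup (g e) v = (if v \<in> J then e v else 0)" for e v
    unfolding g_def by (subst lookup_Abs_poly_mapping) (auto intro: finite_subset[OF _ assms])
  have gm: "g (restrict (Poly_Mapping.lookup m) J) = m" if "m \<in> ?M" for m
  proof (rule poly_mapping_eqI)
    fix v
    from that have "v \<notin> J \<Longrightarrow> Poly_Mapping.lookup m v = 0"
      using in_keys_iff[of v m] by blast
    then show "Poly_Mapping.lookup (g (restrict (Poly_Mapping.lookup m) J)) v = Poly_Mapping.lookup m v"
      unfolding lg by (cases "v \<in> J") simp_all
  qed
  have ge: "restrict (Poly_Mapping.lookup (g e)) J = e" if "e \<in> ?E" for e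
  proof
    fix v show "restrict (Poly_Mapping.lookup (g e)) J v = e v"
      using PiE_arb[OF that, of v] by (cases "v \<in> J") (simp_all add: lg)
  qed
  have mE: "restrict (Poly_Mapping.lookup m) J \<in> ?E" if "m \<in> ?M" for m using that by auto
  have gM: "g e \<in> ?M" if "e \<in> ?E" for e
  proof -
    have "e v \<le> d" if "v \<in> J" for v using PiE_mem[OF \<open>e \<in> ?E\<close> that] by simp
    then show ?thesis by (auto simp: lg in_keys_iff split: if_splits)
  qed
  have bij: "bij_betw (\<lambda>m. restrict (Poly_Mapping.lookup m) J) ?M ?E"
    by (rule bij_betw_byWitness[OF ballI[OF gm] ballI[OF ge] image_subsetI[OF mE] image_subsetI[OF gM]])
  have "card ?E = (d + 1) ^ card J" using assms by (simp add: card_PiE)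
  then show "card ?M = (d + 1) ^ card J" using bij_betw_same_card[OF bij] by simp
  have "finite ?E" using assms by (intro finite_PiE) simp_all
  then show "finite ?M" using bij_betw_finite[OF bij] by simp
qed

lemma lookup_sum_single:
  assumes "finite M"
  shows "Poly_Mapping.lookup (\<Sum>m\<in>M. Poly_Mapping.single m (c m)) k = (if k \<in> M then c k else 0)"
  using assms by (simp add: lookup_sum lookup_single when_def)

lemma alg_independent_monomials:
  assumes "alg_independent x J" "finite M" "\<And>m. m \<in> M \<Longrightarrow> Poly_Mapping.keys m \<subseteq> J"
    and "(\<Sum>m\<in>M. of_rat (c m) * monom_eval x m) = 0" "m \<in> M"
  shows "c m = 0"
proof -
  define p where "p = (\<Sum>m\<in>M. Poly_Mapping.single m (c m))"
  have lp: "Poly_Mapping.lookup p k = (if k \<in> M then c k else 0)" for k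
    unfolding p_def by (rule lookup_sum_single[OF assms(2)])
  have "mpoly_eval of_rat x p = (\<Sum>m\<in>M. of_rat (Poly_Mapping.lookup p m) * monom_eval x m)"
    by (rule mpoly_eval_superset) (use assms(2) in \<open>auto simp: in_keys_iff lp split: if_splits\<close>)
  also have "\<dots> = 0" using assms(4) by (simp add: lp)
  finally have "mpoly_eval of_rat x p = 0" .
  moreover have "mpoly_vars p \<subseteq> J"
    using assms(3) by (force simp: mpoly_vars_def in_keys_iff[of _ p] lp split: if_splits)
  ultimately have "p = 0" using assms(1) by (auto simp: alg_independent_def)
  then show ?thesis using lp[of m] assms(5) by simp
qed

text \<open>
  The values of the polynomials of total degree at most \<open>D\<close> in the variables \<open>I\<close>: a filtration of
  the ring generated by the elements \<open>y i\<close>, whose growth measures the transcendence degree.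
\<close>

definition poly_values :: "('i \<Rightarrow> 'k::field_char_0) \<Rightarrow> 'i set \<Rightarrow> nat \<Rightarrow> 'k set" where
  "poly_values y I D =
     rat_space.span (monom_eval y ` {m. Poly_Mapping.keys m \<subseteq> I \<and> sum (Poly_Mapping.lookup m) I \<le> D})"

lemma poly_values_mult:
  assumes "f \<in> poly_values y I D" "g \<in> poly_values y I D'"
  shows "f * g \<in> poly_values y I (D + D')"
proof -
  let ?M = "\<lambda>D. {m. Poly_Mapping.keys m \<subseteq> I \<and> sum (Poly_Mapping.lookup m) I \<le> D}"
  have mono: "monom_eval y m * g \<in> poly_values y I (D + D')" if m: "m \<in> ?M D" for m
    using assms(2) unfolding poly_values_def
  proof (induction rule: rat_space.span_induct_alt)
    case base
    then show ?case by (simp add: rat_space.span_zero)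
  next
    case (step c a b)
    then obtain m' where m': "a = monom_eval y m'" "m' \<in> ?M D'" by auto
    have "m + m' \<in> ?M (D + D')"
      using m m' Poly_Mapping.keys_add[of m m'] by (auto simp: lookup_add sum.distrib)
    then have "monom_eval y m * a \<in> rat_space.span (monom_eval y ` ?M (D + D'))"
      unfolding m' monom_eval_add[symmetric] by (intro rat_space.span_base imageI)
    from rat_space.span_add[OF rat_space.span_scale[OF this, of c] step(2)]
    moreover have "monom_eval y m * (rat_scale c a + b) = rat_scale c (monom_eval y m * a) + monom_eval y m * b"
      by (simp add: rat_scale_def algebra_simps)
    ultimately show ?case by simp
  qed
  show ?thesis
    using assms(1) unfolding poly_values_def[of y I D]
  proof (induction rule: rat_space.span_induct_alt)
    case base
    then show ?case by (simp add: poly_values_def rat_space.span_zero)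
  next
    case (step c a b)
    then obtain m where m: "a = monom_eval y m" "m \<in> ?M D" by auto
    have "rat_scale c (monom_eval y m * g) + b * g \<in> poly_values y I (D + D')"
      using mono[OF m(2)] step(2) unfolding poly_values_def
      by (intro rat_space.span_add rat_space.span_scale)
    moreover have "(rat_scale c a + b) * g = rat_scale c (monom_eval y m * g) + b * g"
      by (simp add: rat_scale_def algebra_simps m)
    ultimately show ?case by simp
  qed
qed

lemma poly_values_add:
  "f \<in> poly_values y I D \<Longrightarrow> g \<in> poly_values y I D \<Longrightarrow> f + g \<in> poly_values y I D"
  unfolding poly_values_def by (rule rat_space.span_add)

lemma poly_values_uminus: "f \<in> poly_values y I D \<Longrightarrow> - f \<in> poly_values y I D"
  unfolding poly_values_def by (rule rat_space.span_neg)

lemma poly_values_0: "0 \<in> poly_values y I D"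
  unfolding poly_values_def by (rule rat_space.span_zero)

lemma poly_values_1: "1 \<in> poly_values y I D"
  unfolding poly_values_def by (rule rat_space.span_base) (auto intro!: image_eqI[of _ _ 0])

lemma poly_values_var:
  assumes "finite I" "i \<in> I"
  shows "y i \<in> poly_values y I 1"
  unfolding poly_values_def
proof (rule rat_space.span_base, rule image_eqI)
  show "y i = monom_eval y (Poly_Mapping.single i 1)" by (simp add: monom_eval_def)
  show "Poly_Mapping.single i 1 \<in> {m. Poly_Mapping.keys m \<subseteq> I \<and> sum (Poly_Mapping.lookup m) I \<le> (1::nat)}"
    using assms by (simp add: lookup_single when_def)
qed

lemma poly_values_power: "f \<in> poly_values y I D \<Longrightarrow> f ^ n \<in> poly_values y I (n * D)"
proof (induction n)
  case (Suc n)
  then show ?case using poly_values_mult[of f y I D "f ^ n" "n * D"] by simp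
qed (simp add: poly_values_1)

lemma poly_values_prod:
  assumes "\<And>j. j \<in> J \<Longrightarrow> f j \<in> poly_values y I D"
  shows "prod f J \<in> poly_values y I (card J * D)"
  using assms
proof (induction J rule: infinite_finite_induct)
  case (insert j J)
  then show ?case using poly_values_mult[of "f j" y I D "prod f J" "card J * D"] by simp
qed (simp_all add: poly_values_1)

text \<open>
  Quotients of polynomial values form a subfield that contains the generators, and the generated
  field is the smallest such subfield.
\<close>

lemma rat_adjoin_fraction:
  assumes "finite I" "a \<in> rat_adjoin (y ` I)"
  shows "\<exists>D g. g \<in> poly_values y I D \<and> g \<noteq> 0 \<and> a * g \<in> poly_values y I D"
proof -
  let ?F = "{a. \<exists>D g. g \<in> poly_values y I D \<and> g \<noteq> 0 \<and> a * g \<in> poly_values y I D}"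
  have "is_subfield ?F"
    unfolding is_subfield_def
  proof (intro conjI ballI)
    show "0 \<in> ?F" "1 \<in> ?F"
      using poly_values_0 poly_values_1 by (auto intro!: exI[of _ 1])
  next
    fix a b assume "a \<in> ?F" "b \<in> ?F"
    then obtain D g D' g' where g: "g \<in> poly_values y I D" "g \<noteq> 0" "a * g \<in> poly_values y I D"
      "g' \<in> poly_values y I D'" "g' \<noteq> 0" "b * g' \<in> poly_values y I D'" by blast
    note m = poly_values_mult[OF g(1,4)] poly_values_mult[OF g(3,4)] poly_values_mult[OF g(1,6)]
      poly_values_mult[OF g(3,6)]
    have "(a + b) * (g * g') \<in> poly_values y I (D + D')"
      using poly_values_add[OF m(2,3)] by (simp add: algebra_simps)
    with m g show "a + b \<in> ?F"
      by (auto intro!: exI[of _ "D + D'"] exI[of _ "g * g'"])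
    have "(a * b) * (g * g') \<in> poly_values y I (D + D')"
      using m(4) by (simp add: algebra_simps)
    with m g show "a * b \<in> ?F"
      by (auto intro!: exI[of _ "D + D'"] exI[of _ "g * g'"])
  next
    fix a assume "a \<in> ?F"
    then obtain D g where g: "g \<in> poly_values y I D" "g \<noteq> 0" "a * g \<in> poly_values y I D" by blast
    then show "- a \<in> ?F"
      using poly_values_uminus by (auto intro!: exI[of _ D] exI[of _ g])
    show "inverse a \<in> ?F"
    proof (cases "a = 0")
      case True
      then show ?thesis using poly_values_0 poly_values_1 by (auto intro!: exI[of _ 1])
    next
      case False
      then have "inverse a * (a * g) = g" by simp
      with False g have "a * g \<in> poly_values y I D \<and> a * g \<noteq> 0 \<and> inverse a * (a * g) \<in> poly_values y I D"
        by (simp only: mult_eq_0_iff) simp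
      then show ?thesis by blast
    qed
  qed
  moreover have "y ` I \<subseteq> ?F"
    using poly_values_var[OF assms(1)] poly_values_1 by (fastforce intro!: exI[of _ 1])
  ultimately have "rat_adjoin (y ` I) \<subseteq> ?F" by (intro hull_minimal)
  then show ?thesis using assms(2) by blast
qed

lemma rat_adjoin_common_denominator:
  assumes "finite I" "finite J" "x ` J \<subseteq> rat_adjoin (y ` I)"
  shows "\<exists>D g. g \<in> poly_values y I D \<and> g \<noteq> 0 \<and> (\<forall>j\<in>J. x j * g \<in> poly_values y I D)"
  using assms(2,3)
proof (induction J rule: finite_induct)
  case empty
  then show ?case using poly_values_1 by (auto intro!: exI[of _ 1])
next
  case (insert j J)
  then obtain D g where g: "g \<in> poly_values y I D" "g \<noteq> 0" "\<forall>j\<in>J. x j * g \<in> poly_values y I D"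
    by auto
  from insert rat_adjoin_fraction[OF assms(1), of "x j" y] obtain D' g' where
    g': "g' \<in> poly_values y I D'" "g' \<noteq> 0" "x j * g' \<in> poly_values y I D'" by auto
  have "x k * (g * g') \<in> poly_values y I (D + D')" if "k \<in> insert j J" for k
  proof (cases "k \<in> J")
    case True
    then show ?thesis using poly_values_mult[of "x k * g" y I D g' D'] g g' by (simp add: mult.assoc)
  next
    case False
    then show ?thesis using poly_values_mult[of g y I D "x k * g'" D'] g g' that
      by (simp add: algebra_simps)
  qed
  with g g' poly_values_mult[OF g(1) g'(1)] show ?case
    by (intro exI[of _ "D + D'"] exI[of _ "g * g'"]) auto
qed

text \<open>
  Let \<open>g\<close> be a common denominator of the elements \<open>x j\<close>, of
  degree at most \<open>D\<close>.  Multiplied by \<open>g ^ (card J * d)\<close>, the \<open>(d + 1) ^ card J\<close> monomials in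
  \<open>x\<close> with exponents at most \<open>d\<close> become polynomial values of degree at most \<open>card J * d * D\<close>, and
  they stay linearly independent.  On monomials of this degree each weight takes a number of values
  that is linear in \<open>d\<close>, so the space they live in has dimension at most \<open>(C * (d + 1)) ^ card W\<close>
  for a constant \<open>C\<close>.  Comparing the growth in \<open>d\<close> gives the claim.
\<close>

theorem alg_independent_card_le_weights:
  fixes x :: "'v \<Rightarrow> 'k::field_char_0" and y :: "'i \<Rightarrow> 'k" and z :: "'i \<Rightarrow> 'w \<Rightarrow> int"
  assumes fin: "finite I" "finite W" "finite J"
    and weights: "\<And>m m'. Poly_Mapping.keys m \<subseteq> I \<Longrightarrow> Poly_Mapping.keys m' \<subseteq> I \<Longrightarrow>
        (\<And>w. w \<in> W \<Longrightarrow> (\<Sum>i\<in>I. int (Poly_Mapping.lookup m i) * z i w)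
                          = (\<Sum>i\<in>I. int (Poly_Mapping.lookup m' i) * z i w)) \<Longrightarrow>
        monom_eval y m = monom_eval y m'"
    and indep: "alg_independent x J" and sub: "x ` J \<subseteq> rat_adjoin (y ` I)"
  shows "card J \<le> card W"
proof -
  obtain D g where g: "g \<in> poly_values y I D" "g \<noteq> 0" "\<And>j. j \<in> J \<Longrightarrow> x j * g \<in> poly_values y I D"
    using rat_adjoin_common_denominator[OF fin(1,3) sub] by blast
  define c where "c = (\<Sum>i\<in>I. \<Sum>w\<in>W. nat \<bar>z i w\<bar>)"
  have c: "\<bar>z i w\<bar> \<le> int c" if "i \<in> I" "w \<in> W" for i w
  proof -
    have "nat \<bar>z i w\<bar> \<le> (\<Sum>w\<in>W. nat \<bar>z i w\<bar>)" using that fin by (intro member_le_sum) auto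
    also have "\<dots> \<le> c" unfolding c_def
      using that fin by (intro member_le_sum[where f = "\<lambda>i. \<Sum>w\<in>W. nat \<bar>z i w\<bar>"]) auto
    finally show ?thesis by simp
  qed
  let ?N = "card J * D"
  have bound: "(d + 1) ^ card J \<le> ((2 * c * ?N + 1) * (d + 1)) ^ card W" for d
  proof -
    let ?B = "c * (card J * (d * D))"
    let ?P = "{m. Poly_Mapping.keys m \<subseteq> I \<and> sum (Poly_Mapping.lookup m) I \<le> card J * (d * D)}"
    let ?M = "{m. Poly_Mapping.keys m \<subseteq> J \<and> (\<forall>v. Poly_Mapping.lookup m v \<le> d)}"
    define Z where "Z m = (\<lambda>w\<in>W. \<Sum>i\<in>I. int (Poly_Mapping.lookup m i) * z i w)" for m
    have Z_in: "Z m \<in> W \<rightarrow>\<^sub>E {- int ?B..int ?B}" if "m \<in> ?P" for m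
    proof (unfold Z_def, rule restrict_PiE_iff[THEN iffD2], rule ballI)
      fix w assume "w \<in> W"
      have "\<bar>\<Sum>i\<in>I. int (Poly_Mapping.lookup m i) * z i w\<bar> \<le> (\<Sum>i\<in>I. \<bar>int (Poly_Mapping.lookup m i) * z i w\<bar>)"
        by (rule sum_abs)
      also have "\<dots> \<le> (\<Sum>i\<in>I. int (Poly_Mapping.lookup m i) * int c)"
        using c \<open>w \<in> W\<close> by (intro sum_mono) (auto simp: abs_mult intro: mult_left_mono)
      also have "\<dots> = int (sum (Poly_Mapping.lookup m) I * c)"
        by (simp add: sum_distrib_right)
      also have "\<dots> \<le> int ?B"
        using that by (simp only: zle_int mult.commute[of c]) (auto intro: mult_right_mono)
      finally show "(\<Sum>i\<in>I. int (Poly_Mapping.lookup m i) * z i w) \<in> {- int ?B..int ?B}"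
        by (simp add: abs_le_iff)
    qed
    \<comment> \<open>The value of a monomial factors through its weights.\<close>
    define G where "G f = monom_eval y (SOME m. Poly_Mapping.keys m \<subseteq> I \<and> Z m = f)" for f
    have GZ: "monom_eval y m = G (Z m)" if "Poly_Mapping.keys m \<subseteq> I" for m
    proof -
      have s: "Poly_Mapping.keys (SOME k. Poly_Mapping.keys k \<subseteq> I \<and> Z k = Z m) \<subseteq> I \<and>
         Z (SOME k. Poly_Mapping.keys k \<subseteq> I \<and> Z k = Z m) = Z m"
        using that by (intro someI[of "\<lambda>k. Poly_Mapping.keys k \<subseteq> I \<and> Z k = Z m"]) simp
      show ?thesis
        unfolding G_def
      proof (rule weights)
        fix w assume "w \<in> W"
        then show "(\<Sum>i\<in>I. int (Poly_Mapping.lookup m i) * z i w)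
          = (\<Sum>i\<in>I. int (Poly_Mapping.lookup (SOME k. Poly_Mapping.keys k \<subseteq> I \<and> Z k = Z m) i) * z i w)"
          using s by (auto simp: Z_def dest!: fun_cong[of _ _ w])
      qed (use that s in auto)
    qed
    have E: "finite (W \<rightarrow>\<^sub>E {- int ?B..int ?B})" using fin by (intro finite_PiE) auto
    have sub': "monom_eval y ` ?P \<subseteq> G ` (W \<rightarrow>\<^sub>E {- int ?B..int ?B})"
      using GZ Z_in by fast
    then have fin': "finite (monom_eval y ` ?P)" using E finite_subset by blast
    have "card (monom_eval y ` ?P) \<le> card (G ` (W \<rightarrow>\<^sub>E {- int ?B..int ?B}))"
      using sub' E by (intro card_mono) auto
    also have "\<dots> \<le> card (W \<rightarrow>\<^sub>E {- int ?B..int ?B})" by (rule card_image_le[OF E])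
    also have "\<dots> = (2 * ?B + 1) ^ card W"
      using fin by (simp add: card_PiE nat_add_distrib nat_mult_distrib mult_ac)
    finally have le: "card (monom_eval y ` ?P) \<le> (2 * ?B + 1) ^ card W" .
    \<comment> \<open>This power of the denominator clears \<open>d\<close> factors \<open>x j\<close> for every \<open>j\<close>.\<close>
    define f where "f m = g ^ (card J * d) * monom_eval x m" for m
    have "card ?M \<le> card (monom_eval y ` ?P)"
    proof (rule rat_space.independent_family_card_le[where f = f])
      show "finite ?M" by (rule card_monomials_bounded_exponents(2)[OF fin(3)])
      show "finite (monom_eval y ` ?P)" by (rule fin')
      show "f ` ?M \<subseteq> rat_space.span (monom_eval y ` ?P)"
      proof
        fix a assume "a \<in> f ` ?M"
        then obtain m where m: "m \<in> ?M" "a = f m" by auto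
        let ?l = "Poly_Mapping.lookup m"
        have "a = (\<Prod>j\<in>J. g ^ d) * (\<Prod>j\<in>J. x j ^ ?l j)"
          using m monom_eval_superset[OF fin(3), of m x]
          by (simp add: f_def power_mult[symmetric] mult.commute)
        also have "\<dots> = (\<Prod>j\<in>J. (x j * g) ^ ?l j * g ^ (d - ?l j))"
          unfolding prod.distrib[symmetric]
        proof (rule prod.cong)
          fix j
          have "g ^ d = g ^ ?l j * g ^ (d - ?l j)"
            using m by (simp add: power_add[symmetric])
          then show "g ^ d * x j ^ ?l j = (x j * g) ^ ?l j * g ^ (d - ?l j)"
            by (simp add: power_mult_distrib algebra_simps)
        qed simp
        also have "\<dots> \<in> poly_values y I (card J * (d * D))"
        proof (rule poly_values_prod)
          fix j assume "j \<in> J"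
          have "(x j * g) ^ ?l j * g ^ (d - ?l j) \<in> poly_values y I (?l j * D + (d - ?l j) * D)"
            using g \<open>j \<in> J\<close> by (intro poly_values_mult poly_values_power) auto
          also have "?l j * D + (d - ?l j) * D = d * D"
            using m by (simp add: add_mult_distrib[symmetric])
          finally show "(x j * g) ^ ?l j * g ^ (d - ?l j) \<in> poly_values y I (d * D)" .
        qed
        finally show "a \<in> rat_space.span (monom_eval y ` ?P)" unfolding poly_values_def .
      qed
      fix u assume "(\<Sum>m\<in>?M. rat_scale (u m) (f m)) = 0"
      then have "g ^ (card J * d) * (\<Sum>m\<in>?M. of_rat (u m) * monom_eval x m) = 0"
        by (simp add: f_def rat_scale_def sum_distrib_left algebra_simps)
      then have "(\<Sum>m\<in>?M. of_rat (u m) * monom_eval x m) = 0" using g by simp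
      from alg_independent_monomials[OF indep card_monomials_bounded_exponents(2)[OF fin(3)] _ this]
      show "\<forall>m\<in>?M. u m = 0" by simp
    qed
    then have "(d + 1) ^ card J \<le> (2 * ?B + 1) ^ card W"
      using le card_monomials_bounded_exponents(1)[OF fin(3), of d] by simp
    also have "\<dots> \<le> ((2 * c * ?N + 1) * (d + 1)) ^ card W"
      by (intro power_mono) (simp_all add: algebra_simps)
    finally show ?thesis .
  qed
  show ?thesis by (rule exponent_le_if_power_growth_le[OF bound])
qed

lemma mpoly_eval_sum_single:
  assumes "finite M"
  shows "mpoly_eval of_rat x (\<Sum>m\<in>M. Poly_Mapping.single m (c m))
           = (\<Sum>m\<in>M. of_rat (c m) * (monom_eval x m :: 'a::field_char_0))"
  using assms
  by (induction M rule: finite_induct) (simp_all add: mpoly_eval_add of_rat_add mpoly_eval_single)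

text \<open>
  A relation among the \<open>x v\<close> becomes one among the \<open>x' (g v)\<close> when the variables are renamed along
  \<open>g\<close>, and injectivity of \<open>g\<close> keeps different monomials different.
\<close>

lemma alg_independent_reindex:
  assumes inj: "inj_on g J" and indep: "alg_independent x' (g ` J)"
    and x: "\<And>v. v \<in> J \<Longrightarrow> x' (g v) = x v"
  shows "alg_independent x J"
  unfolding alg_independent_def
proof (intro allI impI, elim conjE)
  fix p assume vars: "mpoly_vars p \<subseteq> J" and p0: "mpoly_eval of_rat x p = 0"
  define rl where "rl m = (\<Sum>v\<in>Poly_Mapping.keys m. Poly_Mapping.single (g v) (Poly_Mapping.lookup m v))"
    for m :: "'a \<Rightarrow>\<^sub>0 nat"
  have keysJ: "Poly_Mapping.keys m \<subseteq> J" if "m \<in> Poly_Mapping.keys p" for m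
    using vars that by (auto simp: mpoly_vars_def)
  have lrl: "Poly_Mapping.lookup (rl m) (g v) = Poly_Mapping.lookup m v"
    if "Poly_Mapping.keys m \<subseteq> J" "v \<in> J" for m v
  proof -
    have "Poly_Mapping.lookup (rl m) (g v)
        = (\<Sum>u\<in>Poly_Mapping.keys m. if u = v then Poly_Mapping.lookup m u else 0)"
      unfolding rl_def lookup_sum
      by (rule sum.cong[OF refl]) (use that inj_onD[OF inj] in \<open>auto simp: lookup_single when_def\<close>)
    also have "\<dots> = Poly_Mapping.lookup m v" by (simp add: in_keys_iff)
    finally show ?thesis .
  qed
  have keys_rl: "Poly_Mapping.keys (rl m) \<subseteq> g ` Poly_Mapping.keys m" for m
    unfolding rl_def
    by (rule order_trans[OF Poly_Mapping.keys_sum]) (auto split: if_splits)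
  have ev: "monom_eval x' (rl m) = monom_eval x m" if "Poly_Mapping.keys m \<subseteq> J" for m
  proof -
    have "monom_eval x' (rl m) = (\<Prod>w\<in>g ` Poly_Mapping.keys m. x' w ^ Poly_Mapping.lookup (rl m) w)"
      by (rule monom_eval_superset) (use keys_rl in auto)
    also have "\<dots> = (\<Prod>v\<in>Poly_Mapping.keys m. x' (g v) ^ Poly_Mapping.lookup (rl m) (g v))"
      by (rule prod.reindex[OF inj_on_subset[OF inj that], unfolded o_def])
    also have "\<dots> = monom_eval x m"
      unfolding monom_eval_def
      by (rule prod.cong[OF refl]) (simp add: lrl[OF that] x subsetD[OF that])
    finally show ?thesis .
  qed
  have inj_rl: "inj_on rl (Poly_Mapping.keys p)"
  proof (rule inj_onI)
    fix m m' assume m: "m \<in> Poly_Mapping.keys p" "m' \<in> Poly_Mapping.keys p" "rl m = rl m'"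
    show "m = m'"
    proof (rule poly_mapping_eqI)
      fix v show "Poly_Mapping.lookup m v = Poly_Mapping.lookup m' v"
      proof (cases "v \<in> J")
        case True
        then show ?thesis using lrl[OF keysJ[OF m(1)]] lrl[OF keysJ[OF m(2)]] m(3) by metis
      next
        case False
        then have "v \<notin> Poly_Mapping.keys m" "v \<notin> Poly_Mapping.keys m'" using keysJ m by blast+
        then show ?thesis by (simp add: in_keys_iff)
      qed
    qed
  qed
  define c where "c k = Poly_Mapping.lookup p (inv_into (Poly_Mapping.keys p) rl k)" for k
  have c: "c (rl m) = Poly_Mapping.lookup p m" if "m \<in> Poly_Mapping.keys p" for m
    using that inj_rl by (simp add: c_def)
  have "(\<Sum>k\<in>rl ` Poly_Mapping.keys p. of_rat (c k) * monom_eval x' k)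
      = (\<Sum>m\<in>Poly_Mapping.keys p. of_rat (c (rl m)) * monom_eval x' (rl m))"
    by (rule sum.reindex[OF inj_rl, unfolded o_def])
  also have "\<dots> = mpoly_eval of_rat x p"
    unfolding mpoly_eval_def by (rule sum.cong[OF refl]) (simp add: c ev[OF keysJ])
  finally have sum0: "(\<Sum>k\<in>rl ` Poly_Mapping.keys p. of_rat (c k) * monom_eval x' k) = 0"
    using p0 by simp
  have "c (rl m) = 0" if "m \<in> Poly_Mapping.keys p" for m
    by (rule alg_independent_monomials[OF indep _ _ sum0])
       (use that keys_rl keysJ in \<open>auto, blast\<close>)
  then have "Poly_Mapping.lookup p m = 0" for m
    using c[of m] by (cases "m \<in> Poly_Mapping.keys p") (auto simp: in_keys_iff)
  then show "p = 0" by (intro poly_mapping_eqI) simp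
qed

lemma alg_independent_subset: "alg_independent x J \<Longrightarrow> I \<subseteq> J \<Longrightarrow> alg_independent x I"
  unfolding alg_independent_def by blast

text \<open>
  A repeated value would give the relation that one variable minus another vanishes.
\<close>

lemma alg_independent_inj_on:
  assumes "alg_independent x J"
  shows "inj_on x J"
proof (rule inj_onI, rule ccontr)
  fix u v assume uv: "u \<in> J" "v \<in> J" "x u = x v" "u \<noteq> v"
  let ?u = "Poly_Mapping.single u (1::nat)" and ?v = "Poly_Mapping.single v (1::nat)"
  have "Poly_Mapping.keys ?u \<noteq> Poly_Mapping.keys ?v" using uv(4) by simp
  then have ne: "?u \<noteq> ?v" by metis
  define c where "c k = (if k = ?u then 1 else - 1 :: rat)" for k
  have "(\<Sum>k\<in>{?u, ?v}. of_rat (c k) * monom_eval x k) = 0"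
    using ne uv(3) by (simp add: c_def monom_eval_def)
  moreover have "Poly_Mapping.keys m \<subseteq> J" if "m \<in> {?u, ?v}" for m using that uv(1,2) by auto
  ultimately have "c ?u = 0" by (intro alg_independent_monomials[OF assms, of "{?u, ?v}"]) simp_all
  then show False by (simp add: c_def)
qed

lemma alg_independent_image:
  assumes "alg_independent x J"
  shows "alg_independent (\<lambda>b. b) (x ` J)"
proof (rule alg_independent_reindex[where g = "inv_into J x" and x' = x])
  show "inj_on (inv_into J x) (x ` J)" by (rule inj_on_inv_into) simp
  show "alg_independent x (inv_into J x ` x ` J)"
    by (rule alg_independent_subset[OF assms]) (auto intro: inv_into_into)
qed (simp add: f_inv_into_f)

section \<open>Laurent monomials in the indeterminates\<close>

text \<open>
  The rationals are generated as a field by \<open>1\<close>, so they have a unique homomorphism to a field of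
  characteristic zero.
\<close>

lemma rat_hom_eq_of_rat:
  fixes h :: "rat \<Rightarrow> 'a::field_char_0"
  assumes h1: "h 1 = 1" and add: "\<And>a b. h (a + b) = h a + h b" and mult: "\<And>a b. h (a * b) = h a * h b"
  shows "h q = of_rat q"
proof -
  have h0: "h 0 = 0" using add[of 0 0] by simp
  have nat: "h (of_nat n) = of_nat n" for n by (induction n) (simp_all add: h0 h1 add)
  have int: "h (of_int k) = of_int k" for k
  proof (cases k)
    case (nonneg n)
    then show ?thesis using nat by simp
  next
    case (neg n)
    have "h (- of_nat (Suc n)) + h (of_nat (Suc n)) = 0" unfolding add[symmetric] by (simp add: h0)
    then have "h (- of_nat (Suc n)) = - of_nat (Suc n)" unfolding nat by (rule eq_neg_iff_add_eq_0[THEN iffD2])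
    moreover have "of_int k = - rat_of_nat (Suc n)" "of_int k = - (of_nat (Suc n) :: 'a)"
      using neg by simp_all
    ultimately show ?thesis by (simp only:)
  qed
  obtain a b where q: "q = of_int a / of_int b" "b > 0"
    by (metis quotient_of_div quotient_of_denom_pos surj_pair)
  have "h q * of_int b = h (q * of_int b)" unfolding mult int ..
  also have "q * of_int b = of_int a" using q by simp
  finally have "h q * of_int b = of_int a" unfolding int .
  then have "h q = of_int a / of_int b" using q(2) by (simp add: eq_divide_eq)
  also have "\<dots> = of_rat q" unfolding q(1) of_rat_divide by simp
  finally show ?thesis .
qed

lemma of_rat_diffpoly_fract:
  "(of_rat q :: 'm::linorder diffpoly fract) = to_fract (Poly_Mapping.single 0 q)"
proof (rule rat_hom_eq_of_rat[symmetric, where h = "\<lambda>q. to_fract (Poly_Mapping.single 0 q)"])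
  show "to_fract (Poly_Mapping.single 0 1) = (1 :: 'm diffpoly fract)" by simp
  show "to_fract (Poly_Mapping.single 0 (a + b)) = (to_fract (Poly_Mapping.single 0 a)
      + to_fract (Poly_Mapping.single 0 b) :: 'm diffpoly fract)" for a b
    by (simp add: single_add to_fract_add)
  show "to_fract (Poly_Mapping.single 0 (a * b)) = (to_fract (Poly_Mapping.single 0 a)
      * to_fract (Poly_Mapping.single 0 b) :: 'm diffpoly fract)" for a b
    using mult_single[of "0 :: 'm dvar \<Rightarrow>\<^sub>0 nat" a 0 b] by (simp add: to_fract_mult[symmetric])
qed

lemma difference_field_0: "difference_field \<sigma> \<Longrightarrow> \<sigma> 0 = 0"
  unfolding difference_field_def by (metis add_cancel_right_left)

lemma difference_field_inverse:
  assumes "difference_field \<sigma>"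
  shows "\<sigma> (inverse a) = inverse (\<sigma> a)"
proof (cases "a = 0")
  case False
  then have "\<sigma> a * \<sigma> (inverse a) = 1"
    using assms unfolding difference_field_def by (metis right_inverse)
  then show ?thesis by (rule inverse_unique[symmetric])
qed (simp add: difference_field_0[OF assms])

lemma difference_field_power: "difference_field \<sigma> \<Longrightarrow> \<sigma> (a ^ n) = \<sigma> a ^ n"
  by (induction n) (simp_all add: difference_field_def)

lemma difference_field_power_int: "difference_field \<sigma> \<Longrightarrow> \<sigma> (a powi n) = \<sigma> a powi n"
  by (simp add: power_int_def difference_field_power difference_field_inverse)

lemma difference_field_prod: "difference_field \<sigma> \<Longrightarrow> \<sigma> (\<Prod>i\<in>S. f i) = (\<Prod>i\<in>S. \<sigma> (f i))"
  by (induction S rule: infinite_finite_induct) (simp_all add: difference_field_def)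

lemma sigma_power_superset:
  assumes "degree p \<le> D"
  shows "sigma_power \<sigma> a p = (\<Prod>i\<le>D. (\<sigma> ^^ i) a powi coeff p i)"
  unfolding sigma_power_def
  by (rule prod.mono_neutral_left) (use assms in \<open>auto simp: coeff_eq_0 not_le\<close>)

lemma sigma_power_add:
  assumes "\<And>i. (\<sigma> ^^ i) a \<noteq> 0"
  shows "sigma_power \<sigma> a (p + q) = sigma_power \<sigma> a p * sigma_power \<sigma> a q"
proof -
  let ?D = "max (degree p) (degree q)"
  have "degree (p + q) \<le> ?D" by (rule degree_add_le_max)
  then show ?thesis
    using assms by (simp add: sigma_power_superset[where D = ?D] power_int_add prod.distrib)
qed

lemma sigma_power_pCons_0:
  assumes "difference_field \<sigma>"
  shows "sigma_power \<sigma> a (pCons 0 p) = \<sigma> (sigma_power \<sigma> a p)"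
proof -
  have "sigma_power \<sigma> a (pCons 0 p) = (\<Prod>i\<le>Suc (degree p). (\<sigma> ^^ i) a powi coeff (pCons 0 p) i)"
    by (rule sigma_power_superset) (simp add: degree_pCons_le)
  also have "\<dots> = (\<Prod>i\<le>degree p. (\<sigma> ^^ Suc i) a powi coeff p i)"
    by (subst prod.atMost_Suc_shift) simp
  also have "\<dots> = \<sigma> (sigma_power \<sigma> a p)"
    by (simp add: sigma_power_def difference_field_prod[OF assms] difference_field_power_int[OF assms])
  finally show ?thesis .
qed

lemma T_shift_funpow_T_var: "(T_shift ^^ i) (T_var j) = to_fract (mvar (Dvar j i))"
proof (induction i)
  case (Suc i)
  have "diffpoly_shift (mvar (Dvar j i)) = mvar (Dvar j (Suc i))"
    unfolding diffpoly_shift_def by (subst mpoly_eval_single) (simp_all add: monom_eval_def)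
  then show ?case using Suc by (simp add: to_fract_def T_shift_Fract)
qed (simp add: T_var_def)

lemma T_shift_funpow_T_var_nonzero: "(T_shift ^^ i) (T_var j) \<noteq> 0"
proof -
  have "Poly_Mapping.lookup (mvar (Dvar j i)) (Poly_Mapping.single (Dvar j i) 1) \<noteq> 0" by simp
  then have "mvar (Dvar j i) \<noteq> 0" by (metis lookup_zero)
  then show ?thesis unfolding T_shift_funpow_T_var to_fract_eq_0_iff .
qed

lemma T_monomial_add: "T_monomial (\<beta> + \<gamma>) = T_monomial \<beta> * T_monomial \<gamma>"
  by (simp add: T_monomial_def sigma_power_add T_shift_funpow_T_var_nonzero prod.distrib)

lemma T_monomial_0: "T_monomial 0 = 1"
  by (simp add: T_monomial_def sigma_power_def)

lemma T_monomial_sum: "T_monomial (\<Sum>i\<in>S. f i) = (\<Prod>i\<in>S. T_monomial (f i))"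
  by (induction S rule: infinite_finite_induct) (simp_all add: T_monomial_0 T_monomial_add)

lemma T_monomial_power: "T_monomial \<beta> ^ n = T_monomial (of_nat n *s \<beta>)"
  by (induction n) (simp_all add: T_monomial_0 T_monomial_add vector_sadd_rdistrib)

lemma T_shift_T_monomial: "T_shift (T_monomial \<beta>) = T_monomial (monom 1 1 *s \<beta>)"
  by (simp add: T_monomial_def difference_field_prod difference_field_T_shift sigma_power_pCons_0
      monom_altdef flip: sigma_power_pCons_0)

lemma T_shift_funpow_T_monomial: "(T_shift ^^ j) (T_monomial \<beta>) = T_monomial (monom 1 j *s \<beta>)"
  by (induction j) (simp_all add: T_shift_T_monomial vector_smult_assoc mult_monom flip: one_pCons monom_0)


text \<open>
  The exponents of the monomial of \<open>\<beta>\<close>, faithful only if \<open>\<beta>\<close> has nonnegative coefficients, since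
  \<open>nat\<close> truncates the others to \<open>0\<close>.
\<close>

definition T_exponents :: "int poly ^ 'm::{finite,linorder} \<Rightarrow> ('m dvar \<Rightarrow>\<^sub>0 nat)" where
  "T_exponents \<beta> = (\<Sum>j\<in>UNIV. \<Sum>i\<le>degree (\<beta> $ j).
     Poly_Mapping.single (Dvar j i) (nat (coeff (\<beta> $ j) i)))"

lemma lookup_T_exponents: "Poly_Mapping.lookup (T_exponents \<beta>) (Dvar j i) = nat (coeff (\<beta> $ j) i)"
proof -
  have "Poly_Mapping.lookup (T_exponents \<beta>) (Dvar j i)
      = (\<Sum>j'\<in>UNIV. if j' = j then \<Sum>i'\<le>degree (\<beta> $ j). if i' = i then nat (coeff (\<beta> $ j) i) else 0 else 0)"
    unfolding T_exponents_def lookup_sum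
    by (intro sum.cong refl) (auto simp: lookup_single when_def intro!: sum.cong)
  also have "\<dots> = nat (coeff (\<beta> $ j) i)" by (simp add: coeff_eq_0)
  finally show ?thesis .
qed

lemma to_fract_prod: "to_fract (\<Prod>i\<in>S. f i) = (\<Prod>i\<in>S. to_fract (f i))"
  by (induction S rule: infinite_finite_induct) simp_all

lemma prod_single_eq_single_sum:
  "(\<Prod>i\<in>S. Poly_Mapping.single (f i) (1::rat)) = Poly_Mapping.single (\<Sum>i\<in>S. f i :: 'v \<Rightarrow>\<^sub>0 nat) 1"
  by (induction S rule: infinite_finite_induct) (simp_all add: mult_single)

lemma to_fract_mvar_power: "to_fract (mvar v) ^ n = to_fract (Poly_Mapping.single (Poly_Mapping.single v n) 1)"
  by (induction n) (simp_all add: mult_single single_add[symmetric] flip: to_fract_mult)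

lemma T_monomial_nonneg:
  assumes "\<And>j i. 0 \<le> coeff (\<beta> $ j) i"
  shows "T_monomial \<beta> = to_fract (Poly_Mapping.single (T_exponents \<beta>) 1)"
  unfolding T_exponents_def prod_single_eq_single_sum[symmetric] to_fract_prod
  by (simp add: T_monomial_def sigma_power_def T_shift_funpow_T_var power_int_nonneg_exp assms
      to_fract_mvar_power[unfolded One_nat_def])

text \<open>
  Multiplication by a single monomial with large exponents makes all the exponents nonnegative, and
  turns the claim into linear independence of ordinary monomials in the polynomial ring.
\<close>

lemma T_monomial_linear_independent:
  fixes F :: "(int poly ^ 'm::{finite,linorder}) set"
  assumes fin: "finite F" and sum0: "(\<Sum>\<beta>\<in>F. of_rat (c \<beta>) * T_monomial \<beta>) = 0" and "\<beta> \<in> F"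
  shows "c \<beta> = 0"
proof -
  define S where "S = (\<lambda>(\<beta>, j). \<beta> $ j) ` (F \<times> (UNIV :: 'm set))"
  have "finite S" using fin by (simp add: S_def)
  \<comment> \<open>The sums \<open>D\<close> and \<open>N\<close> are crude upper bounds for degrees and absolute values of coefficients.\<close>
  define D where "D = (\<Sum>p\<in>S. degree p)"
  define N where "N = (\<Sum>p\<in>S. \<Sum>i\<le>degree p. \<bar>coeff p i\<bar>)"
  have D: "degree p \<le> D" if "p \<in> S" for p
    unfolding D_def using that \<open>finite S\<close> by (intro member_le_sum) auto
  have N: "- N \<le> coeff p i" if "p \<in> S" for p i
  proof (cases "i \<le> degree p")
    case True
    have "\<bar>coeff p i\<bar> \<le> (\<Sum>i\<le>degree p. \<bar>coeff p i\<bar>)" using True by (intro member_le_sum) auto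
    also have "\<dots> \<le> N" unfolding N_def
      using that \<open>finite S\<close> by (intro member_le_sum[where f = "\<lambda>p. \<Sum>i\<le>degree p. \<bar>coeff p i\<bar>"]) auto
    finally show ?thesis by linarith
  next
    case False
    have "0 \<le> N" unfolding N_def by (intro sum_nonneg) simp
    then show ?thesis using False by (simp add: coeff_eq_0)
  qed
  define \<gamma> :: "int poly ^ 'm::{finite,linorder}" where "\<gamma> = (\<chi> j. \<Sum>k\<le>D. monom N k)"
  have coeff_\<gamma>: "coeff (\<gamma> $ j) i = (if i \<le> D then N else 0)" for j i
    by (simp add: \<gamma>_def coeff_sum)
  have nonneg: "0 \<le> coeff ((b + \<gamma>) $ j) i" if "b \<in> F" for b j i
  proof -
    have "b $ j \<in> S" using that by (force simp: S_def)
    then show ?thesis using D[of "b $ j"] N[of "b $ j" i] by (auto simp: coeff_\<gamma> coeff_eq_0)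
  qed
  have inj: "b = b'" if "b \<in> F" "b' \<in> F" "T_exponents (b + \<gamma>) = T_exponents (b' + \<gamma>)" for b b'
  proof -
    have "coeff ((b + \<gamma>) $ j) i = coeff ((b' + \<gamma>) $ j) i" for j i
      using nonneg[OF that(1)] nonneg[OF that(2)]
      by (metis that(3) lookup_T_exponents eq_nat_nat_iff)
    then have "(b + \<gamma>) $ j = (b' + \<gamma>) $ j" for j by (intro poly_eqI)
    then show ?thesis by (simp add: vec_eq_iff)
  qed
  define P where "P = (\<Sum>b\<in>F. Poly_Mapping.single (T_exponents (b + \<gamma>)) (c b))"
  have "to_fract P = (\<Sum>b\<in>F. of_rat (c b) * T_monomial (b + \<gamma>))"
    unfolding P_def to_fract_sum
    by (rule sum.cong[OF refl])
       (simp add: T_monomial_nonneg[OF nonneg] of_rat_diffpoly_fract mult_single flip: to_fract_mult)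
  also have "\<dots> = (\<Sum>b\<in>F. of_rat (c b) * T_monomial b) * T_monomial \<gamma>"
    by (simp add: T_monomial_add sum_distrib_right mult.assoc)
  finally have "P = 0" using sum0 by simp
  moreover have "Poly_Mapping.lookup P (T_exponents (\<beta> + \<gamma>)) = (\<Sum>b\<in>F. if b = \<beta> then c b else 0)"
    unfolding P_def lookup_sum
    by (rule sum.cong[OF refl]) (use inj assms(3) in \<open>auto simp: lookup_single when_def\<close>)
  ultimately show ?thesis using fin assms(3) by simp
qed

section \<open>Generic zeros of toric ideals\<close>

text \<open>
  At the toric point, a variable and a monomial take the values of the Laurent monomials with these
  exponents (\<open>monom_eval_toric_point\<close>).
\<close>

definition dvar_exponent :: "int poly ^ 'n ^ 'm \<Rightarrow> 'n dvar \<Rightarrow> int poly ^ 'm" where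
  "dvar_exponent A v = monom 1 (dvar_order v) *s column (dvar_index v) A"

definition monom_exponent :: "int poly ^ 'n ^ 'm \<Rightarrow> ('n dvar \<Rightarrow>\<^sub>0 nat) \<Rightarrow> int poly ^ 'm" where
  "monom_exponent A m = (\<Sum>v\<in>Poly_Mapping.keys m. of_nat (Poly_Mapping.lookup m v) *s dvar_exponent A v)"

definition dvar_value :: "('k \<Rightarrow> 'k) \<Rightarrow> 'k ^ 'n \<Rightarrow> 'n dvar \<Rightarrow> 'k" where
  "dvar_value \<sigma> \<eta> v = (\<sigma> ^^ dvar_order v) (\<eta> $ dvar_index v)"

lemma sigma_eval_eq_mpoly_eval: "sigma_eval \<sigma> \<eta> = mpoly_eval of_rat (dvar_value \<sigma> \<eta>)"
  unfolding sigma_eval_def[abs_def] dvar_value_def[abs_def] ..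

lemma monom_eval_toric_point:
  "monom_eval (dvar_value T_shift (toric_point A)) m = T_monomial (monom_exponent A m)"
  by (simp add: monom_eval_def monom_exponent_def T_monomial_sum T_monomial_power dvar_value_def
      toric_point_def T_shift_funpow_T_monomial dvar_exponent_def)

text \<open>
  A generic zero satisfies exactly the relations of the toric point, where they are relations among
  Laurent monomials.
\<close>

lemma generic_zero_toric_iff:
  assumes "generic_zero \<sigma> (toric_ideal A) \<eta>" "finite M"
  shows "(\<Sum>m\<in>M. of_rat (c m) * monom_eval (dvar_value \<sigma> \<eta>) m) = 0
     \<longleftrightarrow> (\<Sum>m\<in>M. of_rat (c m) * T_monomial (monom_exponent A m)) = 0"
proof -
  let ?f = "\<Sum>m\<in>M. Poly_Mapping.single m (c m)"
  have "sigma_eval \<sigma> \<eta> ?f = 0 \<longleftrightarrow> sigma_eval T_shift (toric_point A) ?f = 0"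
    using assms(1) unfolding generic_zero_def toric_ideal_def by blast
  then show ?thesis
    by (simp add: sigma_eval_eq_mpoly_eval mpoly_eval_sum_single[OF assms(2)] monom_eval_toric_point)
qed

lemma generic_zero_monom_eq:
  assumes "generic_zero \<sigma> (toric_ideal A) \<eta>" "monom_exponent A m = monom_exponent A m'"
  shows "monom_eval (dvar_value \<sigma> \<eta>) m = monom_eval (dvar_value \<sigma> \<eta>) m'"
proof (cases "m = m'")
  case False
  then show ?thesis
    using generic_zero_toric_iff[OF assms(1), of "{m, m'}" "\<lambda>k. if k = m then 1 else - 1"] assms(2)
    by simp
qed simp

text \<open>
  If different monomials have different exponents, a relation at the generic zero is a relation
  among different Laurent monomials, hence trivial.
\<close>

lemma generic_zero_alg_independent:
  assumes gen: "generic_zero \<sigma> (toric_ideal A) \<eta>"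
    and inj: "inj_on (monom_exponent A) {m. Poly_Mapping.keys m \<subseteq> J}"
  shows "alg_independent (dvar_value \<sigma> \<eta>) J"
  unfolding alg_independent_def
proof (intro allI impI, elim conjE)
  fix p assume vars: "mpoly_vars p \<subseteq> J" and p0: "mpoly_eval of_rat (dvar_value \<sigma> \<eta>) p = 0"
  let ?K = "Poly_Mapping.keys p"
  have inj': "inj_on (monom_exponent A) ?K"
    using vars by (intro inj_on_subset[OF inj]) (auto simp: mpoly_vars_def)
  define c where "c \<beta> = Poly_Mapping.lookup p (inv_into ?K (monom_exponent A) \<beta>)" for \<beta>
  have c: "c (monom_exponent A m) = Poly_Mapping.lookup p m" if "m \<in> ?K" for m
    using that inj' by (simp add: c_def)
  have "(\<Sum>m\<in>?K. of_rat (Poly_Mapping.lookup p m) * T_monomial (monom_exponent A m)) = 0"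
    using p0 generic_zero_toric_iff[OF gen, of ?K "Poly_Mapping.lookup p"] by (simp add: mpoly_eval_def)
  then have "(\<Sum>\<beta>\<in>monom_exponent A ` ?K. of_rat (c \<beta>) * T_monomial \<beta>) = 0"
    by (simp add: sum.reindex[OF inj'] c)
  then have "c (monom_exponent A m) = 0" if "m \<in> ?K" for m
    by (rule T_monomial_linear_independent[rotated]) (use that in auto)
  then have "Poly_Mapping.lookup p m = 0" for m using c[of m] by (cases "m \<in> ?K") (auto simp: in_keys_iff)
  then show "p = 0" by (intro poly_mapping_eqI) simp
qed

section \<open>The dimension of the space of exponents\<close>

definition vec_rat_scale :: "rat \<Rightarrow> 'a::field_char_0 ^ 'm \<Rightarrow> 'a ^ 'm" where
  "vec_rat_scale q v = of_rat q *s v"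

interpretation vec_rat: vector_space "vec_rat_scale :: rat \<Rightarrow> 'a::field_char_0 ^ 'm \<Rightarrow> 'a ^ 'm"
  by standard
     (simp_all add: vec_rat_scale_def of_rat_add of_rat_mult vector_add_ldistrib vector_sadd_rdistrib
       vector_smult_assoc)

text \<open>
  Exponents are regarded as vectors over the field of fractions, which is at once a rational
  vector space and the space in which the rank of the matrix is taken.  The indeterminate \<open>x\<close>
  becomes the scalar \<open>to_fract (monom 1 1)\<close>.
\<close>

definition fract_vec :: "int poly ^ 'm \<Rightarrow> int poly fract ^ 'm" where
  "fract_vec \<beta> = (\<chi> i. to_fract (\<beta> $ i))"

lemma fract_vec_eq_iff: "fract_vec \<beta> = fract_vec \<gamma> \<longleftrightarrow> \<beta> = \<gamma>"
  by (simp add: fract_vec_def vec_eq_iff)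

lemma fract_vec_sum: "fract_vec (\<Sum>i\<in>S. f i) = (\<Sum>i\<in>S. fract_vec (f i))"
  by (simp add: fract_vec_def vec_eq_iff)

lemma fract_vec_smult: "fract_vec (p *s \<beta>) = to_fract p *s fract_vec \<beta>"
  by (simp add: fract_vec_def vec_eq_iff)

lemma to_fract_of_nat: "to_fract (of_nat n) = of_nat n"
  by (induction n) simp_all

lemma to_fract_of_int: "to_fract (of_int k) = of_int k"
  by (cases k rule: int_cases2) (simp_all add: to_fract_of_nat)

lemma to_fract_monom: "to_fract (monom c e) = of_rat (of_int c) * (to_fract (monom 1 e) :: int poly fract)"
proof -
  have "monom c e = of_int c * monom 1 e" by (simp add: of_int_poly smult_monom)
  then show ?thesis by (simp add: to_fract_of_int)
qed

definition exponent_vec :: "int poly ^ 'n ^ 'm \<Rightarrow> 'n dvar \<Rightarrow> int poly fract ^ 'm" where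
  "exponent_vec A v = fract_vec (dvar_exponent A v)"

lemma fract_vec_monom_exponent:
  assumes "finite I" "Poly_Mapping.keys m \<subseteq> I"
  shows "fract_vec (monom_exponent A m)
           = (\<Sum>v\<in>I. vec_rat_scale (of_nat (Poly_Mapping.lookup m v)) (exponent_vec A v))"
proof -
  have "fract_vec (monom_exponent A m)
      = (\<Sum>v\<in>Poly_Mapping.keys m. vec_rat_scale (of_nat (Poly_Mapping.lookup m v)) (exponent_vec A v))"
    by (simp add: monom_exponent_def fract_vec_sum fract_vec_smult exponent_vec_def vec_rat_scale_def
        to_fract_of_nat)
  also have "\<dots> = (\<Sum>v\<in>I. vec_rat_scale (of_nat (Poly_Mapping.lookup m v)) (exponent_vec A v))"
    by (rule sum.mono_neutral_left) (use assms in \<open>auto simp: in_keys_iff\<close>)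
  finally show ?thesis .
qed

text \<open>
  The weights of a monomial are the coordinates of its exponent in a rational basis of the span,
  multiplied by a common denominator; they determine the exponent, hence the value at \<open>\<eta>\<close>.
\<close>

lemma generic_zero_card_le_dim:
  assumes gen: "generic_zero \<sigma> (toric_ideal A) \<eta>" and fin: "finite I" "finite J"
    and indep: "alg_independent x J" and sub: "x ` J \<subseteq> rat_adjoin (dvar_value \<sigma> \<eta> ` I)"
  shows "card J \<le> vec_rat.dim (exponent_vec A ` I)"
proof -
  obtain W where W: "W \<subseteq> exponent_vec A ` I" "vec_rat.independent W"
      "exponent_vec A ` I \<subseteq> vec_rat.span W" "card W = vec_rat.dim (exponent_vec A ` I)"
    by (rule vec_rat.basis_exists)
  have finW: "finite W" using W(1) fin(1) by (meson finite_imageI finite_subset)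
  have "\<exists>\<rho>. exponent_vec A v = (\<Sum>w\<in>W. vec_rat_scale (\<rho> w) w)" if "v \<in> I" for v
    using W(3) that unfolding vec_rat.span_finite[OF finW] by fast
  then obtain \<rho> where \<rho>: "\<And>v. v \<in> I \<Longrightarrow> exponent_vec A v = (\<Sum>w\<in>W. vec_rat_scale (\<rho> v w) w)"
    by metis
  have "finite ((\<lambda>(v, w). \<rho> v w) ` (I \<times> W))" using fin finW by simp
  from finite_rats_common_denominator[OF this] obtain q :: int where
    q: "q \<noteq> 0" "\<And>v w. v \<in> I \<Longrightarrow> w \<in> W \<Longrightarrow> of_int q * \<rho> v w \<in> \<int>"
    by auto
  define z where "z v w = \<lfloor>of_int q * \<rho> v w\<rfloor>" for v w
  have z: "of_int (z v w) = of_int q * \<rho> v w" if "v \<in> I" "w \<in> W" for v w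
    using q(2)[OF that] by (simp add: z_def)
  have expand: "fract_vec (monom_exponent A m)
      = (\<Sum>w\<in>W. vec_rat_scale (of_int (\<Sum>v\<in>I. int (Poly_Mapping.lookup m v) * z v w) / of_int q) w)"
    if "Poly_Mapping.keys m \<subseteq> I" for m
  proof -
    have "fract_vec (monom_exponent A m)
        = (\<Sum>v\<in>I. \<Sum>w\<in>W. vec_rat_scale (of_nat (Poly_Mapping.lookup m v) * \<rho> v w) w)"
      unfolding fract_vec_monom_exponent[OF fin(1) that]
      by (rule sum.cong[OF refl]) (simp add: \<rho> vec_rat.scale_sum_right)
    also have "\<dots> = (\<Sum>w\<in>W. vec_rat_scale (\<Sum>v\<in>I. of_nat (Poly_Mapping.lookup m v) * \<rho> v w) w)"
      by (subst sum.swap) (simp add: vec_rat.scale_sum_left)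
    also have "\<dots> = (\<Sum>w\<in>W. vec_rat_scale (of_int (\<Sum>v\<in>I. int (Poly_Mapping.lookup m v) * z v w) / of_int q) w)"
    proof (rule sum.cong[OF refl])
      fix w assume "w \<in> W"
      have "of_int (\<Sum>v\<in>I. int (Poly_Mapping.lookup m v) * z v w)
          = of_int q * (\<Sum>v\<in>I. of_nat (Poly_Mapping.lookup m v) * \<rho> v w)"
        using z \<open>w \<in> W\<close> by (simp add: sum_distrib_left mult.left_commute)
      then show "vec_rat_scale (\<Sum>v\<in>I. of_nat (Poly_Mapping.lookup m v) * \<rho> v w) w
          = vec_rat_scale (of_int (\<Sum>v\<in>I. int (Poly_Mapping.lookup m v) * z v w) / of_int q) w"
        using q(1) by simp
    qed
    finally show ?thesis .
  qed
  have "card J \<le> card W"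
  proof (rule alg_independent_card_le_weights[OF fin(1) finW fin(2) _ indep sub])
    fix m m' :: "'b dvar \<Rightarrow>\<^sub>0 nat"
    assume keys: "Poly_Mapping.keys m \<subseteq> I" "Poly_Mapping.keys m' \<subseteq> I"
      and eq: "\<And>w. w \<in> W \<Longrightarrow> (\<Sum>v\<in>I. int (Poly_Mapping.lookup m v) * z v w)
                              = (\<Sum>v\<in>I. int (Poly_Mapping.lookup m' v) * z v w)"
    have "fract_vec (monom_exponent A m) = fract_vec (monom_exponent A m')"
      unfolding expand[OF keys(1)] expand[OF keys(2)] by (rule sum.cong[OF refl]) (simp only: eq)
    then show "monom_eval (dvar_value \<sigma> \<eta>) m = monom_eval (dvar_value \<sigma> \<eta>) m'"
      unfolding fract_vec_eq_iff by (rule generic_zero_monom_eq[OF gen])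
  qed
  then show ?thesis using W(4) by simp
qed

text \<open>
  The exponent of a monomial is the combination of the exponents of its variables with the powers
  as coefficients, so linear independence lets it determine the monomial.
\<close>

lemma generic_zero_alg_independent_if_exponents:
  assumes gen: "generic_zero \<sigma> (toric_ideal A) \<eta>"
    and indep: "\<And>K c. finite K \<Longrightarrow> K \<subseteq> J \<Longrightarrow> (\<Sum>v\<in>K. vec_rat_scale (c v) (exponent_vec A v)) = 0 \<Longrightarrow>
                  \<forall>v\<in>K. c v = 0"
  shows "alg_independent (dvar_value \<sigma> \<eta>) J"
proof (rule generic_zero_alg_independent[OF gen], rule inj_onI)
  fix m m' assume m: "m \<in> {m. Poly_Mapping.keys m \<subseteq> J}" "m' \<in> {m. Poly_Mapping.keys m \<subseteq> J}"
    and eq: "monom_exponent A m = monom_exponent A m'"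
  let ?K = "Poly_Mapping.keys m \<union> Poly_Mapping.keys m'"
  have "(\<Sum>v\<in>?K. vec_rat_scale (of_nat (Poly_Mapping.lookup m v) - of_nat (Poly_Mapping.lookup m' v)) (exponent_vec A v)) = 0"
    using eq fract_vec_monom_exponent[of ?K m A] fract_vec_monom_exponent[of ?K m' A]
    by (simp add: vec_rat.scale_left_diff_distrib sum_subtractf)
  then have "\<forall>v\<in>?K. of_nat (Poly_Mapping.lookup m v) - of_nat (Poly_Mapping.lookup m' v) = (0::rat)"
    by (rule indep[rotated 2]) (use m in auto)
  then have "Poly_Mapping.lookup m v = Poly_Mapping.lookup m' v" for v
    by (cases "v \<in> ?K") (auto simp: in_keys_iff)
  then show "m = m'" by (rule poly_mapping_eqI)
qed

text \<open>
  The lower bound comes from a basis of the span that is chosen among the exponents of the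
  variables: the values of the chosen variables are algebraically independent.
\<close>

lemma generic_zero_trdeg:
  assumes gen: "generic_zero \<sigma> (toric_ideal A) \<eta>" and fin: "finite I"
  shows "trdeg (rat_adjoin (dvar_value \<sigma> \<eta> ` I)) = enat (vec_rat.dim (exponent_vec A ` I))"
proof (rule antisym)
  show "trdeg (rat_adjoin (dvar_value \<sigma> \<eta> ` I)) \<le> enat (vec_rat.dim (exponent_vec A ` I))"
    unfolding trdeg_def
    by (rule SUP_least) (auto intro!: generic_zero_card_le_dim[OF gen fin])
next
  obtain W where W: "W \<subseteq> exponent_vec A ` I" "vec_rat.independent W"
      "exponent_vec A ` I \<subseteq> vec_rat.span W" "card W = vec_rat.dim (exponent_vec A ` I)"
    by (rule vec_rat.basis_exists)
  have finW: "finite W" using W(1) fin by (meson finite_imageI finite_subset)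
  define J where "J = inv_into I (exponent_vec A) ` W"
  have JI: "J \<subseteq> I" using W(1) by (auto simp: J_def intro: inv_into_into)
  have E_inv: "exponent_vec A (inv_into I (exponent_vec A) w) = w" if "w \<in> W" for w
    using W(1) that by (auto intro: f_inv_into_f)
  have inj: "inj_on (exponent_vec A) J"
    by (rule inj_onI) (auto simp: J_def E_inv)
  have "card J = card W"
    unfolding J_def by (rule card_image) (rule inj_on_inv_into[OF W(1)])
  have alg: "alg_independent (dvar_value \<sigma> \<eta>) J"
  proof (rule generic_zero_alg_independent_if_exponents[OF gen], rule ballI)
    fix K c v
    assume K: "finite K" "K \<subseteq> J" "(\<Sum>v\<in>K. vec_rat_scale (c v) (exponent_vec A v)) = 0" "v \<in> K"
    have injK: "inj_on (exponent_vec A) K" using inj K(2) by (rule inj_on_subset)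
    define u where "u w = c (inv_into K (exponent_vec A) w)" for w
    have u: "u (exponent_vec A k) = c k" if "k \<in> K" for k using that injK by (simp add: u_def)
    have "(\<Sum>w\<in>exponent_vec A ` K. vec_rat_scale (u w) w) = 0"
      using K(3) by (simp add: sum.reindex[OF injK] u)
    moreover have "exponent_vec A ` K \<subseteq> W" using K(2) E_inv by (auto simp: J_def)
    ultimately have "u (exponent_vec A v) = 0"
      using K by (intro vec_rat.independentD[OF W(2), of "exponent_vec A ` K"]) auto
    then show "c v = 0" using u K by simp
  qed
  let ?B = "dvar_value \<sigma> \<eta> ` J"
  have "?B \<in> {B. B \<subseteq> rat_adjoin (dvar_value \<sigma> \<eta> ` I) \<and> finite B \<and> alg_independent (\<lambda>b. b) B}"
    using JI finite_subset[OF JI fin] alg_independent_image[OF alg] by (auto intro!: hull_inc)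
  moreover have "card ?B = vec_rat.dim (exponent_vec A ` I)"
    using card_image[OF alg_independent_inj_on[OF alg]] \<open>card J = card W\<close> W(4) by simp
  ultimately show "enat (vec_rat.dim (exponent_vec A ` I)) \<le> trdeg (rat_adjoin (dvar_value \<sigma> \<eta> ` I))"
    unfolding trdeg_def by (metis (no_types, lifting) SUP_upper)
qed

section \<open>The growth of the space of exponents\<close>

text \<open>
  Extend a basis \<open>B\<^sub>0\<close> of the first span to a basis \<open>B\<^sub>1\<close> of the second.  Since \<open>f\<close> sends \<open>B\<^sub>0\<close> into
  the second span, the third one is generated by \<open>B\<^sub>1\<close> and the images of the vectors in
  \<open>B\<^sub>1 - B\<^sub>0\<close>.
\<close>

lemma (in vector_space) dim_iterate_concave:
  assumes f: "\<And>a b. f (a + b) = f a + f b" "\<And>c a. f (scale c a) = scale c (f a)"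
    and S: "finite S\<^sub>1" "S\<^sub>0 \<subseteq> S\<^sub>1" "f ` S\<^sub>0 \<subseteq> S\<^sub>1" "S\<^sub>2 \<subseteq> S\<^sub>1 \<union> f ` S\<^sub>1"
  shows "dim S\<^sub>2 + dim S\<^sub>0 \<le> 2 * dim S\<^sub>1"
proof -
  interpret f: module_hom scale scale f
    by unfold_locales (use f in auto)
  obtain B\<^sub>0 where B0: "B\<^sub>0 \<subseteq> S\<^sub>0" "independent B\<^sub>0" "S\<^sub>0 \<subseteq> span B\<^sub>0" "card B\<^sub>0 = dim S\<^sub>0"
    by (rule basis_exists)
  have "B\<^sub>0 \<subseteq> S\<^sub>1" using B0(1) S(2) by simp
  from maximal_independent_subset_extend[OF this B0(2)] obtain B\<^sub>1 where
    B1: "B\<^sub>0 \<subseteq> B\<^sub>1" "B\<^sub>1 \<subseteq> S\<^sub>1" "independent B\<^sub>1" "S\<^sub>1 \<subseteq> span B\<^sub>1" .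
  have fin: "finite B\<^sub>1" using B1(2) S(1) finite_subset by blast
  have dim1: "dim S\<^sub>1 = card B\<^sub>1" using B1 by (intro dim_unique) auto
  let ?B = "B\<^sub>1 \<union> f ` (B\<^sub>1 - B\<^sub>0)"
  have sub: "span B\<^sub>1 \<subseteq> span ?B" by (rule span_mono) simp
  have "f ` B\<^sub>1 \<subseteq> span ?B"
  proof
    fix v assume "v \<in> f ` B\<^sub>1"
    then obtain b where b: "b \<in> B\<^sub>1" "v = f b" by blast
    show "v \<in> span ?B"
    proof (cases "b \<in> B\<^sub>0")
      case True
      then have "v \<in> S\<^sub>1" using b B0(1) S(3) by blast
      then show ?thesis using B1(4) sub by blast
    next
      case False
      then show ?thesis using b by (intro span_base) blast
    qed
  qed
  then have "span (f ` B\<^sub>1) \<subseteq> span ?B" by (rule span_minimal) simp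
  moreover have "f ` S\<^sub>1 \<subseteq> span (f ` B\<^sub>1)"
    using B1(4) by (simp add: f.span_image image_mono)
  ultimately have "S\<^sub>2 \<subseteq> span ?B" using S(4) B1(4) sub by blast
  then have "dim S\<^sub>2 \<le> card ?B" using fin by (intro dim_le_card) simp_all
  also have "\<dots> \<le> card B\<^sub>1 + card (f ` (B\<^sub>1 - B\<^sub>0))" by (rule card_Un_le)
  finally have "dim S\<^sub>2 \<le> card B\<^sub>1 + card (f ` (B\<^sub>1 - B\<^sub>0))" .
  moreover have "card (f ` (B\<^sub>1 - B\<^sub>0)) \<le> card (B\<^sub>1 - B\<^sub>0)" using fin by (intro card_image_le) simp
  moreover have "card (B\<^sub>1 - B\<^sub>0) = card B\<^sub>1 - card B\<^sub>0"
    using B1(1) fin by (intro card_Diff_subset finite_subset[OF B1(1)])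
  moreover have "card B\<^sub>0 \<le> card B\<^sub>1" using B1(1) fin by (rule card_mono[rotated])
  ultimately show ?thesis using dim1 B0(4) by linarith
qed

lemma exponent_vec_eq: "exponent_vec A v = to_fract (monom 1 (dvar_order v)) *s fract_vec (column (dvar_index v) A)"
  by (simp add: exponent_vec_def dvar_exponent_def fract_vec_smult)

lemma exponent_vec_Suc: "exponent_vec A (Dvar k (Suc j)) = to_fract (monom 1 1) *s exponent_vec A (Dvar k j)"
  by (simp add: exponent_vec_eq vector_smult_assoc mult_monom flip: to_fract_mult)

lemma dvars_le_eq_image: "{v :: 'n dvar. dvar_order v \<le> t} = (\<lambda>(k, j). Dvar k j) ` (UNIV \<times> {..t})"
proof -
  have "v \<in> (\<lambda>(k, j). Dvar k j) ` (UNIV \<times> {..t})" if "dvar_order v \<le> t" for v :: "'n dvar"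
    using that by (intro image_eqI[of _ _ "(dvar_index v, dvar_order v)"]) auto
  then show ?thesis by auto
qed

lemma finite_dvars_le: "finite {v :: 'n::finite dvar. dvar_order v \<le> t}"
  unfolding dvars_le_eq_image by (intro finite_imageI) simp

text \<open>
  The Hilbert function of the module generated by the columns of the matrix.
\<close>

definition exponent_dim :: "int poly ^ 'n ^ 'm \<Rightarrow> nat \<Rightarrow> nat" where
  "exponent_dim A t = vec_rat.dim (exponent_vec A ` {v. dvar_order v \<le> t})"

lemma exponent_dim_concave:
  "exponent_dim A (t + 2) + exponent_dim A t \<le> 2 * exponent_dim A (t + 1)"
  unfolding exponent_dim_def
proof (rule vec_rat.dim_iterate_concave[where f = "\<lambda>v. to_fract (monom 1 1) *s v"])
  let ?V = "\<lambda>t. exponent_vec A ` {v. dvar_order v \<le> t}"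
  show "finite (?V (t + 1))" by (intro finite_imageI finite_dvars_le)
  show "?V t \<subseteq> ?V (t + 1)" by auto
  show "(*s) (to_fract (monom 1 1)) ` ?V t \<subseteq> ?V (t + 1)"
  proof
    fix w assume "w \<in> (*s) (to_fract (monom 1 1)) ` ?V t"
    then obtain v where v: "dvar_order v \<le> t" "w = to_fract (monom 1 1) *s exponent_vec A v" by auto
    then have "w = exponent_vec A (Dvar (dvar_index v) (Suc (dvar_order v)))"
      by (simp only: exponent_vec_Suc dvar.collapse)
    then show "w \<in> ?V (t + 1)" using v(1) by auto
  qed
  show "?V (t + 2) \<subseteq> ?V (t + 1) \<union> (*s) (to_fract (monom 1 1)) ` ?V (t + 1)"
  proof
    fix w assume "w \<in> ?V (t + 2)"
    then obtain k j where w: "j \<le> t + 2" "w = exponent_vec A (Dvar k j)"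
      by (metis (mono_tags, lifting) dvar.collapse imageE mem_Collect_eq)
    show "w \<in> ?V (t + 1) \<union> (*s) (to_fract (monom 1 1)) ` ?V (t + 1)"
    proof (cases j)
      case 0
      then show ?thesis using w by auto
    next
      case (Suc j')
      then show ?thesis using w by (auto simp: exponent_vec_Suc)
    qed
  qed
qed (simp_all add: vec_rat_scale_def vector_add_ldistrib vector_smult_assoc mult.commute)

text \<open>
  All exponents are combinations of the vectors with a power of \<open>x\<close> between \<open>u i\<close> and \<open>d i + t\<close> in
  coordinate i and zeros elsewhere.  The coefficients of the shifted column are those of \<open>A\<close> moved
  up by at most \<open>t\<close>.
\<close>

lemma exponent_dim_le:
  assumes coeffs: "\<And>i k e. coeff (A $ i $ k) e \<noteq> 0 \<Longrightarrow> u i \<le> e \<and> e \<le> d i"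
  shows "exponent_dim A t \<le> (\<Sum>i\<in>UNIV. d i + t + 1 - u i)"
proof -
  let ?I = "SIGMA i:UNIV. {u i..d i + t}"
  let ?W = "(\<lambda>(i, e). to_fract (monom (1::int) e) *s axis i 1) ` ?I"
  have "exponent_vec A v \<in> vec_rat.span ?W" if v: "dvar_order v \<le> t" for v
  proof -
    let ?p = "\<lambda>i. dvar_exponent A v $ i"
    have p: "?p i = (\<Sum>e\<in>{u i..d i + t}. monom (coeff (?p i) e) e)" for i
    proof (rule poly_eqI)
      fix e
      have "coeff (?p i) e = 0" if "e \<notin> {u i..d i + t}"
      proof (rule ccontr)
        assume *: "coeff (?p i) e \<noteq> 0"
        then have "coeff (A $ i $ dvar_index v) (e - dvar_order v) \<noteq> 0" "dvar_order v \<le> e"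
          by (auto simp: dvar_exponent_def column_def coeff_monom_mult split: if_splits)
        with coeffs[OF this(1)] v that show False by auto
      qed
      then show "coeff (?p i) e = coeff (\<Sum>e\<in>{u i..d i + t}. monom (coeff (?p i) e) e) e"
        by (auto simp: coeff_sum)
    qed
    have "exponent_vec A v = (\<Sum>i\<in>UNIV. to_fract (?p i) *s axis i 1)"
      by (simp add: exponent_vec_def fract_vec_def vec_eq_iff axis_def if_distrib cong: if_cong)
    also have "\<dots> = (\<Sum>i\<in>UNIV. \<Sum>e\<in>{u i..d i + t}.
        vec_rat_scale (of_int (coeff (?p i) e)) (to_fract (monom 1 e) *s axis i 1))"
    proof (rule sum.cong[OF refl])
      fix i
      have "to_fract (?p i) = (\<Sum>e\<in>{u i..d i + t}. of_rat (of_int (coeff (?p i) e)) * to_fract (monom 1 e))"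
        by (subst p) (simp only: to_fract_sum to_fract_monom[symmetric])
      then show "to_fract (?p i) *s axis i 1 = (\<Sum>e\<in>{u i..d i + t}.
          vec_rat_scale (of_int (coeff (?p i) e)) (to_fract (monom 1 e) *s axis i 1))"
        by (simp add: vec_rat_scale_def vec.scale_sum_left vector_smult_assoc)
    qed
    also have "\<dots> \<in> vec_rat.span ?W"
      by (intro vec_rat.span_sum vec_rat.span_scale vec_rat.span_base) force
    finally show ?thesis .
  qed
  then have "exponent_vec A ` {v. dvar_order v \<le> t} \<subseteq> vec_rat.span ?W" by auto
  then have "exponent_dim A t \<le> card ?W"
    unfolding exponent_dim_def by (rule vec_rat.dim_le_card) (intro finite_imageI finite_SigmaI, simp_all)
  also have "\<dots> \<le> card ?I" by (intro card_image_le finite_SigmaI) simp_all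
  also have "\<dots> = (\<Sum>i\<in>UNIV. d i + t + 1 - u i)" by (simp add: card_SigmaI)
  finally show ?thesis .
qed

lemma to_fract_X_transcendental:
  fixes c :: "nat \<Rightarrow> rat"
  assumes sum0: "(\<Sum>j\<le>T. of_rat (c j) * (to_fract (monom 1 j) :: int poly fract)) = 0" and "j \<le> T"
  shows "c j = 0"
proof -
  from finite_rats_common_denominator[of "c ` {..T}"] obtain q where
    q: "q \<noteq> 0" "\<And>j. j \<le> T \<Longrightarrow> of_int q * c j \<in> \<int>" by auto
  define z where "z j = \<lfloor>of_int q * c j\<rfloor>" for j
  have z: "of_int (z j) = of_int q * c j" if "j \<le> T" for j using q(2)[OF that] by (simp add: z_def)
  have "to_fract (\<Sum>j\<le>T. monom (z j) j) = (\<Sum>j\<le>T. of_rat (of_int (z j)) * (to_fract (monom 1 j) :: int poly fract))"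
    by (simp only: to_fract_sum to_fract_monom[symmetric])
  also have "\<dots> = of_int q * (\<Sum>j\<le>T. of_rat (c j) * to_fract (monom 1 j))"
    unfolding sum_distrib_left
    by (rule sum.cong[OF refl]) (simp only: z atMost_iff of_rat_mult of_rat_of_int_eq mult.assoc)
  also have "\<dots> = 0" unfolding sum0 by simp
  finally have "(\<Sum>j\<le>T. monom (z j) j) = 0" unfolding to_fract_eq_0_iff .
  then have "coeff (\<Sum>j\<le>T. monom (z j) j) j = 0" by simp
  then have "z j = 0" using assms(2) by (simp add: coeff_sum)
  then show ?thesis using z[OF assms(2)] q(1) by simp
qed

text \<open>
  The row space is spanned by the \<open>CARD('m)\<close> rows and has this dimension, so the rows are pairwise
  different and form a basis.
\<close>

lemma full_rank_independent_rows:
  fixes M :: "'a::field ^ 'n ^ 'm"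
  assumes "rank M = CARD('m)" and c: "(\<Sum>i\<in>UNIV. c i *s row i M) = 0"
  shows "c i = 0"
proof -
  have r: "rows M = range (\<lambda>i. row i M)" by (auto simp: rows_def)
  then have fin: "finite (rows M)" by simp
  have le: "card (rows M) \<le> CARD('m)"
    using card_image_le[of UNIV "\<lambda>i. row i M"] by (simp add: r)
  have indep: "vec.independent (rows M)"
    using assms(1) le fin unfolding row_rank_def_gen
    by (intro vec.card_le_dim_spanning[of _ "rows M"]) (auto intro: vec.span_base)
  have "card (rows M) = CARD('m)"
    using assms(1) le vec.dim_le_card'[OF fin] unfolding row_rank_def_gen by simp
  then have inj: "inj (\<lambda>i. row i M)"
    by (intro eq_card_imp_inj_on) (simp_all add: r)
  have "(\<Sum>v\<in>rows M. c (inv (\<lambda>i. row i M) v) *s v) = 0"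
      unfolding r using c by (simp add: sum.reindex[OF inj] inv_f_f[OF inj])
  from vec.independentD[OF indep fin order_refl this, of "row i M"] show ?thesis
    by (simp add: r inv_f_f[OF inj])
qed

text \<open>
  Independence of the rows makes the matrix right invertible.  Its columns then span the whole
  space, and a basis can be chosen among them.
\<close>

lemma full_rank_independent_columns:
  fixes M :: "'a::field ^ 'n ^ 'm"
  assumes "rank M = CARD('m)"
  shows "\<exists>K. card K = CARD('m) \<and> (\<forall>g. (\<Sum>k\<in>K. g k *s column k M) = 0 \<longrightarrow> (\<forall>k\<in>K. g k = 0))"
proof -
  have "\<exists>B. M ** B = mat 1"
    using full_rank_independent_rows[OF assms] matrix_right_invertible_independent_rows by blast
  then have span: "vec.span (columns M) = UNIV" using matrix_right_invertible_span_columns by blast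
  obtain B where B: "B \<subseteq> columns M" "vec.independent B" "columns M \<subseteq> vec.span B"
      "card B = vec.dim (columns M)"
    by (rule vec.basis_exists)
  have "vec.dim (columns M) = vec.dim (UNIV :: ('a ^ 'm) set)"
    using span vec.dim_span[of "columns M"] by simp
  then have cardB: "card B = CARD('m)" using B(4) by (simp only: vec_dim_card)
  have cB: "B \<subseteq> range (\<lambda>k. column k M)" using B(1) by (auto simp: columns_def)
  define h where "h = inv_into UNIV (\<lambda>k. column k M)"
  have h: "column (h b) M = b" if "b \<in> B" for b
    unfolding h_def using cB that by (intro f_inv_into_f) blast
  show ?thesis
  proof (intro exI[of _ "h ` B"] conjI allI impI)
    have "inj_on h B" by (rule inj_onI) (metis h)
    then show "card (h ` B) = CARD('m)" using cardB by (simp add: card_image)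
    fix g assume "(\<Sum>k\<in>h ` B. g k *s column k M) = 0"
    then have "(\<Sum>b\<in>B. g (h b) *s b) = 0" by (simp add: sum.reindex[OF \<open>inj_on h B\<close>] h)
    moreover have "finite B" using cardB card.infinite by fastforce
    ultimately show "\<forall>k\<in>h ` B. g k = 0"
      using vec.independentD[OF B(2) \<open>finite B\<close> order_refl] by fastforce
  qed
qed

text \<open>
  Collecting the terms of a rational relation by columns gives a relation whose coefficients
  \<open>g k\<close> are rational polynomials in \<open>x\<close>; these vanish by independence of the columns, and their
  coefficients vanish because \<open>x\<close> is transcendental.
\<close>

lemma exponents_independent:
  assumes indep: "\<And>g. (\<Sum>k\<in>K. g k *s fract_vec (column k A)) = 0 \<Longrightarrow> \<forall>k\<in>K. g k = 0"
    and C: "finite C" "C \<subseteq> {v. dvar_index v \<in> K}"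
    and sum0: "(\<Sum>v\<in>C. vec_rat_scale (c v) (exponent_vec A v)) = 0"
  shows "\<forall>v\<in>C. c v = 0"
proof
  fix v assume "v \<in> C"
  define T where "T = Max (dvar_order ` C)"
  have T: "dvar_order v \<le> T" if "v \<in> C" for v using that C(1) by (auto simp: T_def)
  define c' where "c' v = (if v \<in> C then c v else 0)" for v
  define g where "g k = (\<Sum>j\<le>T. of_rat (c' (Dvar k j)) * (to_fract (monom 1 j) :: int poly fract))" for k
  let ?D = "\<lambda>(k, j). Dvar k j"
  have inj: "inj_on ?D (K \<times> {..T})" by (auto intro!: inj_onI)
  have sub: "C \<subseteq> ?D ` (K \<times> {..T})"
  proof
    fix v assume "v \<in> C"
    then show "v \<in> ?D ` (K \<times> {..T})"
      using T C(2) by (intro image_eqI[of _ _ "(dvar_index v, dvar_order v)"]) auto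
  qed
  have finK: "finite K" by (rule finite_subset[OF subset_UNIV finite])
  have "(\<Sum>k\<in>K. g k *s fract_vec (column k A))
      = (\<Sum>k\<in>K. \<Sum>j\<le>T. vec_rat_scale (c' (Dvar k j)) (exponent_vec A (Dvar k j)))"
    by (simp add: g_def vec.scale_sum_left vec_rat_scale_def exponent_vec_eq vector_smult_assoc)
  also have "\<dots> = (\<Sum>v\<in>?D ` (K \<times> {..T}). vec_rat_scale (c' v) (exponent_vec A v))"
    by (subst sum.reindex[OF inj]) (simp add: sum.cartesian_product case_prod_beta)
  also have "\<dots> = (\<Sum>v\<in>C. vec_rat_scale (c' v) (exponent_vec A v))"
    using sub finK by (intro sum.mono_neutral_right) (auto simp: c'_def)
  also have "\<dots> = 0" using sum0 by (simp add: c'_def)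
  finally have "\<forall>k\<in>K. g k = 0" by (rule indep)
  then have "g (dvar_index v) = 0" using C(2) \<open>v \<in> C\<close> by blast
  from to_fract_X_transcendental[OF this[unfolded g_def] T[OF \<open>v \<in> C\<close>]]
  show "c v = 0" using \<open>v \<in> C\<close> by (simp add: c'_def)
qed

lemma exponent_dim_ge:
  assumes indep: "\<And>g. (\<Sum>k\<in>K. g k *s fract_vec (column k A)) = 0 \<Longrightarrow> \<forall>k\<in>K. g k = 0"
  shows "card K * (t + 1) \<le> exponent_dim A t"
proof -
  let ?E = "exponent_vec A ` {v. dvar_order v \<le> t}"
  obtain W where W: "W \<subseteq> ?E" "?E \<subseteq> vec_rat.span W" "card W = vec_rat.dim ?E"
    by (rule vec_rat.basis_exists)
  have finW: "finite W" by (rule finite_subset[OF W(1) finite_imageI[OF finite_dvars_le]])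
  let ?C = "(\<lambda>(k, j). Dvar k j) ` (K \<times> {..t})"
  have "inj_on (\<lambda>(k, j). Dvar k j) (K \<times> {..t})" by (auto intro!: inj_onI)
  then have "card ?C = card K * (t + 1)" by (simp add: card_image card_cartesian_product)
  moreover have "card ?C \<le> card W"
  proof (rule vec_rat.independent_family_card_le[where f = "exponent_vec A"])
    have "finite K" by (rule finite_subset[OF subset_UNIV finite])
    then show "finite ?C" by simp
    show "finite W" by (rule finW)
    show "exponent_vec A ` ?C \<subseteq> vec_rat.span W" using W(2) by auto
    show "\<forall>v\<in>?C. c v = 0" if "(\<Sum>v\<in>?C. vec_rat_scale (c v) (exponent_vec A v)) = 0" for c
      by (rule exponents_independent[OF indep \<open>finite ?C\<close> _ that]) auto
  qed
  ultimately show ?thesis using W(3) by (simp add: exponent_dim_def)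
qed

section \<open>The dimension of a generic zero\<close>

lemma is_subfieldD:
  assumes "is_subfield F"
  shows "0 \<in> F" "1 \<in> F" "a \<in> F \<Longrightarrow> b \<in> F \<Longrightarrow> a + b \<in> F" "a \<in> F \<Longrightarrow> b \<in> F \<Longrightarrow> a * b \<in> F"
    "a \<in> F \<Longrightarrow> - a \<in> F" "a \<in> F \<Longrightarrow> inverse a \<in> F"
  using assms unfolding is_subfield_def by blast+

lemma is_subfield_rat_adjoin: "is_subfield (rat_adjoin S)"
  by (rule hull_in) (auto simp: is_subfield_def)

lemma difference_field_rat_adjoin:
  assumes \<sigma>: "difference_field \<sigma>" and "a \<in> rat_adjoin S" "\<sigma> ` S \<subseteq> rat_adjoin S'"
  shows "\<sigma> a \<in> rat_adjoin S'"
proof -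
  have sub: "is_subfield (rat_adjoin S')" by (rule is_subfield_rat_adjoin)
  have neg: "\<sigma> (- a) = - \<sigma> a" for a
  proof -
    have "\<sigma> (- a) + \<sigma> a = \<sigma> (- a + a)" using \<sigma> unfolding difference_field_def by metis
    then show ?thesis using difference_field_0[OF \<sigma>] by (simp add: eq_neg_iff_add_eq_0)
  qed
  have "is_subfield {a. \<sigma> a \<in> rat_adjoin S'}"
    using sub \<sigma> unfolding is_subfield_def difference_field_def
    by (auto simp: neg difference_field_0[OF \<sigma>] difference_field_inverse[OF \<sigma>])
  then have "rat_adjoin S \<subseteq> {a. \<sigma> a \<in> rat_adjoin S'}"
    using assms(3) by (intro hull_minimal) auto
  then show ?thesis using assms(2) by blast
qed

lemma difference_field_funpow_rat_adjoin:
  assumes \<sigma>: "difference_field \<sigma>" and a: "a \<in> rat_adjoin (dvar_value \<sigma> \<eta> ` {v. dvar_order v \<le> s})"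
  shows "(\<sigma> ^^ j) a \<in> rat_adjoin (dvar_value \<sigma> \<eta> ` {v. dvar_order v \<le> s + j})"
proof (induction j)
  case (Suc j)
  have "\<sigma> ` dvar_value \<sigma> \<eta> ` {v. dvar_order v \<le> s + j} \<subseteq> rat_adjoin (dvar_value \<sigma> \<eta> ` {v. dvar_order v \<le> s + Suc j})"
  proof clarify
    fix v :: "'b dvar" assume "dvar_order v \<le> s + j"
    then have "dvar_value \<sigma> \<eta> (Dvar (dvar_index v) (Suc (dvar_order v)))
        \<in> rat_adjoin (dvar_value \<sigma> \<eta> ` {v. dvar_order v \<le> s + Suc j})"
      by (intro hull_inc imageI) simp
    then show "\<sigma> (dvar_value \<sigma> \<eta> v) \<in> rat_adjoin (dvar_value \<sigma> \<eta> ` {v. dvar_order v \<le> s + Suc j})"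
      by (simp add: dvar_value_def)
  qed
  from difference_field_rat_adjoin[OF \<sigma> Suc this] show ?case by simp
qed (use a in simp)

text \<open>
  The fields generated by the transforms of bounded order form an increasing chain whose union is
  the field generated by all transforms.
\<close>

lemma rat_adjoin_dvars_bounded_order:
  assumes "finite B" "B \<subseteq> rat_adjoin (range (dvar_value \<sigma> \<eta>))"
  shows "\<exists>s. B \<subseteq> rat_adjoin (dvar_value \<sigma> \<eta> ` {v. dvar_order v \<le> s})"
proof -
  let ?F = "\<lambda>s. rat_adjoin (dvar_value \<sigma> \<eta> ` {v. dvar_order v \<le> s})"
  have mono: "?F s \<subseteq> ?F s'" if "s \<le> s'" for s s'
    by (intro hull_mono image_mono) (use that in auto)
  have sub: "is_subfield (?F s)" for s by (rule is_subfield_rat_adjoin)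
  define U where "U = (\<Union>s. ?F s)"
  have U: "a \<in> ?F s \<Longrightarrow> a \<in> U" for a s unfolding U_def by blast
  have "is_subfield U"
    unfolding is_subfield_def
  proof (intro conjI ballI)
    show "0 \<in> U" "1 \<in> U" using is_subfieldD(1,2)[OF sub] by (blast intro: U)+
  next
    fix a b assume "a \<in> U" "b \<in> U"
    then obtain s s' where "a \<in> ?F s" "b \<in> ?F s'" unfolding U_def by blast
    then have "a \<in> ?F (max s s')" "b \<in> ?F (max s s')"
      using mono[of s "max s s'"] mono[of s' "max s s'"] by auto
    then show "a + b \<in> U" "a * b \<in> U"
      using is_subfieldD(3,4)[OF sub] by (blast intro: U)+
  next
    fix a assume "a \<in> U"
    then obtain s where "a \<in> ?F s" unfolding U_def by blast
    then show "- a \<in> U" "inverse a \<in> U"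
      using is_subfieldD(5,6)[OF sub] by (blast intro: U)+
  qed
  moreover have "range (dvar_value \<sigma> \<eta>) \<subseteq> U"
  proof clarify
    fix v
    have "dvar_value \<sigma> \<eta> v \<in> ?F (dvar_order v)" by (intro hull_inc imageI) simp
    then show "dvar_value \<sigma> \<eta> v \<in> U" by (rule U)
  qed
  ultimately have "rat_adjoin (range (dvar_value \<sigma> \<eta>)) \<subseteq> U" by (intro hull_minimal)
  then have "\<forall>b\<in>B. \<exists>s. b \<in> ?F s" using assms(2) unfolding U_def by blast
  then obtain s where s: "\<And>b. b \<in> B \<Longrightarrow> b \<in> ?F (s b)" by metis
  have "b \<in> ?F (Max (s ` B))" if "b \<in> B" for b
    using s[OF that] mono[of "s b" "Max (s ` B)"] that assms(1) by auto
  then show ?thesis by blast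
qed

lemma shifts_eq_image: "{(\<sigma> ^^ j) (\<eta> $ i) | i j. P j} = dvar_value \<sigma> \<eta> ` {v. P (dvar_order v)}"
proof -
  have "(\<sigma> ^^ j) (\<eta> $ i) \<in> dvar_value \<sigma> \<eta> ` {v. P (dvar_order v)}" if "P j" for i j
    by (rule image_eqI[of _ _ "Dvar i j"]) (use that in \<open>simp_all add: dvar_value_def\<close>)
  moreover have "dvar_value \<sigma> \<eta> v \<in> {(\<sigma> ^^ j) (\<eta> $ i) | i j. P j}" if "P (dvar_order v)" for v
    using that unfolding dvar_value_def by blast
  ultimately show ?thesis by blast
qed

lemma shifts_eq_range: "{(\<sigma> ^^ j) (\<eta> $ i) | i j. True} = range (dvar_value \<sigma> \<eta>)"
  using shifts_eq_image[where P = "\<lambda>_. True"] by simp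

lemma generic_zero_trdeg_shifts:
  assumes "generic_zero \<sigma> (toric_ideal A) \<eta>"
  shows "trdeg (rat_adjoin {(\<sigma> ^^ j) (\<eta> $ i) | i j. j \<le> t}) = enat (exponent_dim A t)"
  unfolding shifts_eq_image exponent_dim_def
  by (rule generic_zero_trdeg[OF assms finite_dvars_le])

text \<open>
  If \<open>b\<close> elements are difference-independent, their transforms up to order \<open>t\<close> are \<open>b (t + 1)\<close>
  independent elements of the field generated by transforms of order at most \<open>s + t\<close>, for a fixed
  \<open>s\<close>.  The upper bound on the Hilbert function then forces \<open>b \<le> card K\<close> as \<open>t\<close> grows.  Conversely,
  the coordinates of \<open>\<eta>\<close> at the independent columns are difference-independent.
\<close>

lemma generic_zero_point_dim:
  assumes \<sigma>: "difference_field \<sigma>" and gen: "generic_zero \<sigma> (toric_ideal A) \<eta>"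
    and indep: "\<And>g. (\<Sum>k\<in>K. g k *s fract_vec (column k A)) = 0 \<Longrightarrow> \<forall>k\<in>K. g k = 0"
    and upper: "\<And>t. exponent_dim A t \<le> card K * (t + 1) + H"
  shows "point_dim \<sigma> \<eta> = enat (card K)"
proof (rule antisym)
  show "point_dim \<sigma> \<eta> \<le> enat (card K)"
    unfolding point_dim_def sigma_trdeg_def shifts_eq_range
  proof (rule SUP_least, clarify)
    fix B assume B: "B \<subseteq> rat_adjoin (range (dvar_value \<sigma> \<eta>))" "finite B"
      and alg: "alg_independent (\<lambda>(b, j). (\<sigma> ^^ j) b) (B \<times> (UNIV :: nat set))"
    obtain s where s: "B \<subseteq> rat_adjoin (dvar_value \<sigma> \<eta> ` {v. dvar_order v \<le> s})"
      using rat_adjoin_dvars_bounded_order[OF B(2,1)] by blast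
    have le: "card B * (t + 1) \<le> card K * (s + t + 1) + H" for t
    proof -
      have "(\<sigma> ^^ j) b \<in> rat_adjoin (dvar_value \<sigma> \<eta> ` {v. dvar_order v \<le> s + t})" if "b \<in> B" "j \<le> t" for b j
      proof -
        have "(\<sigma> ^^ j) b \<in> rat_adjoin (dvar_value \<sigma> \<eta> ` {v. dvar_order v \<le> s + j})"
          using s that by (intro difference_field_funpow_rat_adjoin[OF \<sigma>]) blast
        also have "\<dots> \<subseteq> rat_adjoin (dvar_value \<sigma> \<eta> ` {v. dvar_order v \<le> s + t})"
          by (intro hull_mono image_mono) (use that in auto)
        finally show ?thesis .
      qed
      then have "(\<lambda>(b, j). (\<sigma> ^^ j) b) ` (B \<times> {..t}) \<subseteq> rat_adjoin (dvar_value \<sigma> \<eta> ` {v. dvar_order v \<le> s + t})"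
        by auto
      moreover have "alg_independent (\<lambda>(b, j). (\<sigma> ^^ j) b) (B \<times> {..t})"
        by (rule alg_independent_subset[OF alg]) auto
      ultimately have "card (B \<times> {..t}) \<le> vec_rat.dim (exponent_vec A ` {v. dvar_order v \<le> s + t})"
        using B(2) by (intro generic_zero_card_le_dim[OF gen finite_dvars_le]) auto
      then show ?thesis
        using upper[of "s + t"] by (simp add: card_cartesian_product exponent_dim_def)
    qed
    have "card B \<le> card K"
    proof (rule ccontr)
      assume "\<not> card B \<le> card K"
      \<comment> \<open>For this \<open>t\<close> the surplus \<open>t + 1\<close> exceeds the constant \<open>card K * s + H\<close>.\<close>
      define t where "t = card K * s + H"
      have "(card K + 1) * (t + 1) \<le> card B * (t + 1)"
        using \<open>\<not> card B \<le> card K\<close> by (intro mult_right_mono) auto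
      also note le[of t]
      finally show False by (simp add: t_def algebra_simps)
    qed
    then show "enat (card B) \<le> enat (card K)" by simp
  qed
next
  let ?J = "{v. dvar_index v \<in> K}"
  have alg: "alg_independent (dvar_value \<sigma> \<eta>) ?J"
    by (rule generic_zero_alg_independent_if_exponents[OF gen]) (rule exponents_independent[OF indep])
  have inj: "inj_on (\<lambda>k. \<eta> $ k) K"
  proof (rule inj_onI)
    fix k k' assume k: "k \<in> K" "k' \<in> K" "\<eta> $ k = \<eta> $ k'"
    then have "dvar_value \<sigma> \<eta> (Dvar k 0) = dvar_value \<sigma> \<eta> (Dvar k' 0)" by (simp add: dvar_value_def)
    from inj_onD[OF alg_independent_inj_on[OF alg] this] k show "k = k'" by simp
  qed
  define h where "h = inv_into K (\<lambda>k. \<eta> $ k)"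
  have h: "h (\<eta> $ k) = k" if "k \<in> K" for k using that inj by (simp add: h_def)
  let ?B = "(\<lambda>k. \<eta> $ k) ` K"
  have "alg_independent (\<lambda>(b, j). (\<sigma> ^^ j) b) (?B \<times> (UNIV :: nat set))"
  proof (rule alg_independent_reindex[where g = "\<lambda>(b, j). Dvar (h b) j" and x' = "dvar_value \<sigma> \<eta>"])
    show "inj_on (\<lambda>(b, j). Dvar (h b) j) (?B \<times> UNIV)" by (rule inj_onI) (auto simp: h)
    show "alg_independent (dvar_value \<sigma> \<eta>) ((\<lambda>(b, j). Dvar (h b) j) ` (?B \<times> UNIV))"
      by (rule alg_independent_subset[OF alg]) (auto simp: h)
  qed (auto simp: dvar_value_def h)
  moreover have "?B \<subseteq> rat_adjoin (range (dvar_value \<sigma> \<eta>))"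
  proof clarify
    fix k
    have "dvar_value \<sigma> \<eta> (Dvar k 0) \<in> rat_adjoin (range (dvar_value \<sigma> \<eta>))" by (intro hull_inc rangeI)
    then show "\<eta> $ k \<in> rat_adjoin (range (dvar_value \<sigma> \<eta>))" by (simp add: dvar_value_def)
  qed
  moreover have "finite K" by (rule finite_subset[OF subset_UNIV finite])
  ultimately have "enat (card ?B) \<le> point_dim \<sigma> \<eta>"
    unfolding point_dim_def sigma_trdeg_def shifts_eq_range by (intro SUP_upper) auto
  then show "enat (card K) \<le> point_dim \<sigma> \<eta>" by (simp add: card_image[OF inj])
qed

section \<open>The order\<close>

lemma generic_zero_has_order_iff:
  assumes "generic_zero \<sigma> (toric_ideal A) \<eta>" "point_dim \<sigma> \<eta> = enat d"
  shows "has_order \<sigma> \<eta> h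
     \<longleftrightarrow> (\<forall>\<^sub>F t in sequentially. int (exponent_dim A t) = int d * (int t + 1) + h)"
proof -
  have "ereal_of_enat (enat (exponent_dim A t)) = ereal_of_enat (enat d) * ereal (real (t + 1)) + ereal (real_of_int h)
      \<longleftrightarrow> int (exponent_dim A t) = int d * (int t + 1) + h" for t
  proof -
    have "ereal_of_enat (enat (exponent_dim A t)) = ereal_of_enat (enat d) * ereal (real (t + 1)) + ereal (real_of_int h)
      \<longleftrightarrow> real_of_int (int (exponent_dim A t)) = real_of_int (int d * (int t + 1) + h)"
      by (simp add: add.commute)
    then show ?thesis unfolding of_int_eq_iff .
  qed
  then show ?thesis
    unfolding has_order_def generic_zero_trdeg_shifts[OF assms(1)] assms(2) by simp
qed

lemma poly_lower_deg_le: "coeff p e \<noteq> 0 \<Longrightarrow> poly_lower_deg p \<le> e"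
  by (auto simp: poly_lower_deg_def intro: Least_le)

lemma row_lower_deg_le: "coeff (A $ i $ k) e \<noteq> 0 \<Longrightarrow> row_lower_deg A i \<le> e"
proof -
  assume "coeff (A $ i $ k) e \<noteq> 0"
  then have "poly_lower_deg (A $ i $ k) \<le> e" by (rule poly_lower_deg_le)
  moreover have "row_lower_deg A i \<le> poly_lower_deg (A $ i $ k)" unfolding row_lower_deg_def by (intro Min_le) auto
  ultimately show ?thesis by simp
qed

text \<open>
  Only a row of zeros has degree \<open>- \<infinity>\<close>.
\<close>

lemma row_deg_eq_degree:
  assumes "A $ i $ k \<noteq> 0"
  obtains d where "row_deg A i = ereal (real d)" "\<And>k e. coeff (A $ i $ k) e \<noteq> 0 \<Longrightarrow> e \<le> d"
proof -
  have ge: "poly_deg (A $ i $ k) \<le> row_deg A i" for k unfolding row_deg_def by (intro Max_ge) auto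
  have "row_deg A i \<in> range (\<lambda>k. poly_deg (A $ i $ k))" unfolding row_deg_def by (intro Max_in) auto
  then obtain k' where k': "row_deg A i = poly_deg (A $ i $ k')" by blast
  have "A $ i $ k' \<noteq> 0" using ge[of k] assms k' by (auto simp: poly_deg_def)
  then have eq: "row_deg A i = ereal (real (degree (A $ i $ k')))" using k' by (simp add: poly_deg_def)
  show thesis
  proof (rule that[OF eq])
    fix l e assume e: "coeff (A $ i $ l) e \<noteq> 0"
    then have "A $ i $ l \<noteq> 0" by auto
    then have "degree (A $ i $ l) \<le> degree (A $ i $ k')" using ge[of l] eq by (simp add: poly_deg_def)
    then show "e \<le> degree (A $ i $ k')" using le_degree[OF e] by simp
  qed
qed

theorem theorem6p32:
  fixes A :: "int poly ^ 'n ^ 'm::{finite,linorder}"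
    and \<sigma> :: "'k::field_char_0 \<Rightarrow> 'k"
    and \<eta> :: "'k ^ 'n"
  assumes "poly_matrix_rank A = CARD('m)"
    and "difference_field \<sigma>"
    and "generic_zero \<sigma> (toric_ideal A) \<eta>"
  shows "ereal (real_of_int (variety_order \<sigma> (toric_variety A \<sigma>)))
           \<le> (\<Sum>i\<in>UNIV. row_deg A i - ereal (real (row_lower_deg A i)))"
proof -
  let ?m = "CARD('m)" and ?u = "row_lower_deg A"
  let ?M = "\<chi> i k. to_fract (A $ i $ k)"
  have col: "column k ?M = fract_vec (column k A)" for k
    by (simp add: column_def fract_vec_def vec_eq_iff)
  obtain K where cardK: "card K = ?m"
    and indep: "\<And>g. (\<Sum>k\<in>K. g k *s fract_vec (column k A)) = 0 \<Longrightarrow> \<forall>k\<in>K. g k = 0"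
    using full_rank_independent_columns[OF assms(1)[unfolded poly_matrix_rank_def], unfolded col] by blast
  \<comment> \<open>A zero row would contradict the full rank, so all degrees of rows are finite.\<close>
  have nonzero: "\<exists>k. A $ i $ k \<noteq> 0" for i
  proof (rule ccontr)
    assume "\<nexists>k. A $ i $ k \<noteq> 0"
    then have "row i ?M = 0" by (simp add: row_def vec_eq_iff)
    then have "(\<Sum>j\<in>UNIV. (if j = i then 1 else 0) *s row j ?M) = 0"
      by (intro sum.neutral) simp
    from full_rank_independent_rows[OF assms(1)[unfolded poly_matrix_rank_def] this, of i]
    show False by simp
  qed
  have "\<exists>d. row_deg A i = ereal (real d) \<and> (\<forall>k e. coeff (A $ i $ k) e \<noteq> 0 \<longrightarrow> e \<le> d)" for i
    using nonzero[of i] by (metis row_deg_eq_degree)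
  then obtain d where d: "\<And>i. row_deg A i = ereal (real (d i))"
      "\<And>i k e. coeff (A $ i $ k) e \<noteq> 0 \<Longrightarrow> e \<le> d i"
    by metis
  have u_le_d: "?u i \<le> d i" for i
  proof -
    obtain k where "A $ i $ k \<noteq> 0" using nonzero by blast
    then have "coeff (A $ i $ k) (degree (A $ i $ k)) \<noteq> 0" by simp
    with d(2)[OF this] row_lower_deg_le[OF this] show ?thesis by simp
  qed
  define H where "H = (\<Sum>i\<in>UNIV. d i - ?u i)"
  have upper: "exponent_dim A t \<le> ?m * (t + 1) + H" for t
  proof -
    have "exponent_dim A t \<le> (\<Sum>i\<in>UNIV. d i + t + 1 - ?u i)"
      using d(2) row_lower_deg_le by (intro exponent_dim_le) blast
    also have "\<dots> = (\<Sum>i\<in>UNIV. (t + 1) + (d i - ?u i))"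
    proof (rule sum.cong[OF refl])
      fix i show "d i + t + 1 - ?u i = (t + 1) + (d i - ?u i)" using u_le_d[of i] by simp
    qed
    also have "\<dots> = ?m * (t + 1) + H" unfolding H_def sum.distrib by simp
    finally show ?thesis .
  qed
  have lower: "?m * (t + 1) \<le> exponent_dim A t" for t
    using exponent_dim_ge[OF indep] cardK by simp
  define s where "s t = int (exponent_dim A t) - int ?m * (int t + 1)" for t
  have "\<exists>h\<le>int H. \<forall>\<^sub>F t in sequentially. s t = h"
  proof (rule concave_bounded_eventually_const)
    fix t
    show "s (t + 2) - s (t + 1) \<le> s (t + 1) - s t"
      using exponent_dim_concave[of A t] by (simp add: s_def algebra_simps)
    have "int (?m * (t + 1)) \<le> int (exponent_dim A t)" "int (exponent_dim A t) \<le> int (?m * (t + 1) + H)"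
      using lower[of t] upper[of t] by (simp_all only: zle_int)
    then show "0 \<le> s t" "s t \<le> int H" by (simp_all add: s_def algebra_simps)
  qed
  then obtain h where h: "h \<le> int H" "\<forall>\<^sub>F t in sequentially. s t = h" by blast
  \<comment> \<open>The order is a definite description: \<open>h\<close> has to be the order of every generic point.\<close>
  have order_iff: "has_order \<sigma> \<xi> h' \<longleftrightarrow> h' = h" if gen: "generic_zero \<sigma> (toric_ideal A) \<xi>" for \<xi> h'
  proof -
    have "point_dim \<sigma> \<xi> = enat ?m"
      using generic_zero_point_dim[OF assms(2) gen indep, of H] upper by (simp add: cardK)
    then have "has_order \<sigma> \<xi> h' \<longleftrightarrow> (\<forall>\<^sub>F t in sequentially. s t = h')"
      by (simp add: generic_zero_has_order_iff[OF gen] s_def algebra_simps)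
    also have "\<dots> \<longleftrightarrow> h' = h"
    proof
      assume "\<forall>\<^sub>F t in sequentially. s t = h'"
      with h(2) have "\<forall>\<^sub>F t in sequentially. h' = h" by eventually_elim simp
      then show "h' = h" by simp
    qed (use h(2) in simp)
    finally show ?thesis .
  qed
  have "variety_order \<sigma> (toric_variety A \<sigma>) = h"
    unfolding variety_order_def generic_point_toric_variety_iff[OF assms(3)]
    using order_iff assms(3) by (intro the_equality) blast+
  then have "real_of_int (variety_order \<sigma> (toric_variety A \<sigma>)) \<le> real H" using h(1) by linarith
  also have "real H = (\<Sum>i\<in>UNIV. real (d i) - real (?u i))"
    unfolding H_def using u_le_d by (simp add: of_nat_diff)
  finally have "ereal (real_of_int (variety_order \<sigma> (toric_variety A \<sigma>)))
      \<le> ereal (\<Sum>i\<in>UNIV. real (d i) - real (?u i))" by simp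
  also have "\<dots> = (\<Sum>i\<in>UNIV. row_deg A i - ereal (real (?u i)))"
    unfolding d(1) by simp
  finally show ?thesis .
qed

end
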